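(* For every $f\in\mathcal{H}$ there exists a unique $F_f\in\mathcal{A}_1^1$ such that \[ \widetilde{f}(z_s^{\delta}w)=z_s^{\delta}\,(F_f\diamond_s w) \] holds for every $s\in\mu_r$ and every $w\in\mathcal{A}_r$. (Moreover $F_f$ can be taken to be the polynomial defined recursively in the context.)
   Context: Fix an integer $r\ge 1$ and let $\mu_r$ be the set of $r$th roots of unity in $\mathbb{C}$. Let $\mathcal{A}_r=\mathbb{Q}\langle x,y_s\mid s\in\mu_r\rangle$ be the free noncommutative polynomial algebra over $\mathbb{Q}$ on the letters $x$ and $y_s$ ($s\in\mu_r$); words form a basis and $\deg$ is word length. Write $y=y_1$, $z=x+y_1$, $z_s=x+y_s$, $\delta(1)=0$ and $\delta(s)=1$ for $s\neq 1$, $z_s^{\delta}=x+\delta(s)y_s$ (so $z_1^\delta=x$), and $z_{k,s}=x^{k-1}y_s$ ($k\ge1$). Let $\mathcal{A}_1=\mathbb{Q}\langle x,y\rangle\subset\mathcal{A}_r$ and $\mathcal{A}_1^1=\mathbb{Q}\oplus\mathcal{A}_1y$. $R_w$ denotes right multiplication by $w$, and $R_w^{-1}$ denotes removal of a final factor $w$ (applied only to elements of $\mathcal{A}_r w$). Harmonic product: the $\mathbb{Q}$-bilinear product $\ast$ on $\mathcal{A}_r$ with $1\ast w=w\ast 1=w$, $vy_s\ast wy_t=(v\ast wy_t)y_s+(vy_s\ast w)y_t+(v\ast w)xy_{st}$, and $vx\ast w=v\ast wx=(v\ast w)x$ ($v,w\in\mathcal{A}_r$, $s,t\in\mu_r$).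 Let $\varphi$ be the algebra automorphism of $\mathcal{A}_r$ with $\varphi(x)=z$, $\varphi(y_s)=\delta(s)y_s-y_1$. Every word is uniquely $z_{k_1,s_1}\cdots z_{k_l,s_l}x^a$ ($l,a\ge0$); define linear maps $\mathcal{I}(z_{k_1,s_1}\cdots z_{k_l,s_l}x^a)=z_{k_1,s_1}z_{k_2,s_1s_2}\cdots z_{k_l,s_1\cdots s_l}x^a$ and $M_s(z_{k_1,s_1}\cdots z_{k_l,s_l}x^a)=z_{k_1,ss_1}z_{k_2,s_2}\cdots z_{k_l,s_l}x^a$ (with $M_s(x^a)=x^a$), and $\psi_s=\varphi\circ\mathcal{I}\circ M_s$ (a linear bijection). Diamond product: for $s\in\mu_r$, $\diamond_s:\mathcal{A}_1\times\mathcal{A}_r\to\mathcal{A}_r$ is the $\mathbb{Q}$-bilinear map defined recursively on words by $1\diamond_s w=w$, $v\diamond_s1=\psi_s\varphi(v)$, and for $v\in\mathcal{A}_1$, $w\in\mathcal{A}_r$, $1\ne t\in\mu_r$: $vx\diamond_s wx=(v\diamond_s wx)x-(vy\diamond_s w)x$; $vy\diamond_s wx=(v\diamond_s wx)y+(vy\diamond_s w)x$; $vx\diamond_s wy=(v\diamond_s wy)x+(vx\diamond_s w)y$; $vy\diamond_s wy=(v\diamond_s wy)y-(vx\diamond_s w)y$; $vx\diamond_s wy_t=(v\diamond_s wy_t)x+(v\diamond_s wz_t)y_t-(vy\diamond_s w)y_t$; $vy\diamond_s wy_t=(v\diamond_s wy_t)y-(v\diamond_s wz_t)y_t+(vy\diamond_s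 w)y_t$. Rooted trees: $\mathcal{H}$ is the Connes–Kreimer Hopf algebra over $\mathbb{Q}$: the commutative polynomial algebra on (non-planar) rooted trees, with basis the rooted forests and unit the empty forest $\mathbb{I}$; $\bullet$ is the one-vertex tree. $B_+$ is the linear map sending a forest to the tree obtained by attaching all its roots to a new root ($B_+(\mathbb{I})=\bullet$). The coproduct $\Delta$ is the algebra map with $\Delta(\mathbb{I})=\mathbb{I}\otimes\mathbb{I}$ and $\Delta(B_+(f))=B_+(f)\otimes\mathbb{I}+(\mathrm{id}\otimes B_+)\Delta(f)$; the counit kills nonempty forests; $S$ is the antipode. Write $\Delta(f)=\sum_{(f)}f'\otimes f''$. Rooted tree maps: $\widetilde{\mathbb{I}}=\mathrm{id}$, and for each forest $f\ne\mathbb{I}$ the linear map $\widetilde{f}:\mathcal{A}_r\to\mathcal{A}_r$ is determined by $\widetilde f(1)=0$ and: (I) $\widetilde{\bullet}(z_s^\delta)=z_s^\delta(z-z_s^\delta)$, $\widetilde{\bullet}(z)=0$; (II) for a forest $f\ne\mathbb{I}$, $\widetilde{B_+(f)}(z_s^\delta)=R_{z-z_s^\delta}R_{2z-z_s^\delta}R_{z-z_s^\delta}^{-1}\widetilde f(z_s^\delta)$ and $\widetilde{B_+(f)}(z)=0$; (III) if $f=gh$, $\widetilde f(v)=\widetilde g(\widetilde h(v))$ for $v\in\{z,z_s^\delta\mid s\in\mu_r\}$; (IV) $\widetilde f(wv)=\sum_{(f)}\widetilde{f'}(w)\widetilde{f''}(v)$ for $w\in\mathcal{A}_r$, $v\in\{z,z_s^\delta\mid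 s\in\mu_r\}$. These are well defined and $f\mapsto\widetilde f$ extends linearly to an algebra homomorphism $\mathcal{H}\to\mathrm{End}_{\mathbb{Q}}(\mathcal{A}_r)$. The polynomials $F_f$: $F_{\mathbb{I}}=1$, $F_\bullet=y$, $F_{B_+(g)}=R_yR_{x+2y}R_y^{-1}(F_g)$ for forests $g\ne\mathbb{I}$, $F_{gh}=F_g\diamond_1F_h$, extended linearly in $f$. *)

theory Defs
  imports "HOL-Library.Multiset" "HOL-Library.Poly_Mapping" Complex_Main
begin

text \<open>Letters: X is x, Y s is y_s (s a complex number; only s in mu r are used in A_r).
  Words are letter lists, polynomials are finitely supported functions word => rat.\<close>

datatype letter = X | Y complex
type_synonym word = "letter list"
type_synonym poly = "word \<Rightarrow>\<^sub>0 rat"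

definition mu :: "nat \<Rightarrow> complex set" where
  "mu r = {s. s ^ r = 1}"

definition dl :: "complex \<Rightarrow> rat" where
  "dl s = (if s = 1 then 0 else 1)"

definition wd :: "word \<Rightarrow> poly" where
  "wd u = Poly_Mapping.single u 1"

definition onep :: poly where "onep = wd []"

definition lt :: "letter \<Rightarrow> poly" where
  "lt a = wd [a]"

definition sm :: "rat \<Rightarrow> poly \<Rightarrow> poly" where
  "sm c P = Poly_Mapping.map (\<lambda>a. c * a) P"

definition lin :: "(word \<Rightarrow> poly) \<Rightarrow> poly \<Rightarrow> poly" where
  "lin g P = (\<Sum>u\<in>Poly_Mapping.keys P. sm (Poly_Mapping.lookup P u) (g u))"

definition pmul :: "poly \<Rightarrow> poly \<Rightarrow> poly" where
  "pmul P Q = (\<Sum>u\<in>Poly_Mapping.keys P. \<Sum>v\<in>Poly_Mapping.keys Q. Poly_Mapping.single (u @ v) (Poly_Mapping.lookup P u * Poly_Mapping.lookup Q v))"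

definition prodl :: "poly list \<Rightarrow> poly" where
  "prodl ps = foldr pmul ps onep"

definition xx :: poly where "xx = lt X"
definition yy :: "complex \<Rightarrow> poly" where "yy s = lt (Y s)"
definition y :: poly where "y = yy 1"
definition z :: poly where "z = xx + y"
definition zs :: "complex \<Rightarrow> poly" where "zs s = xx + yy s"
definition zd :: "complex \<Rightarrow> poly" where "zd s = xx + sm (dl s) (yy s)"

definition Ar :: "nat \<Rightarrow> poly set" where
  "Ar r = {P. \<forall>u\<in>Poly_Mapping.keys P. \<forall>a\<in>set u. a = X \<or> (\<exists>s\<in>mu r. a = Y s)}"

definition A1 :: "poly set" where
  "A1 = {P. \<forall>u\<in>Poly_Mapping.keys P. set u \<subseteq> {X, Y 1}}"

definition A11 :: "poly set" where
  "A11 = {P \<in> A1. \<forall>u\<in>Poly_Mapping.keys P. u = [] \<or> last u = Y 1}"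

definition Rm :: "poly \<Rightarrow> poly \<Rightarrow> poly" where
  "Rm w P = pmul P w"

definition Rinv :: "poly \<Rightarrow> poly \<Rightarrow> poly" where
  "Rinv w P = (THE Q. pmul Q w = P)"

fun phil :: "letter \<Rightarrow> poly" where
  "phil X = z"
| "phil (Y s) = sm (dl s) (yy s) - y"

definition phi :: "poly \<Rightarrow> poly" where
  "phi = lin (\<lambda>u. prodl (map phil u))"

fun Iaux :: "complex \<Rightarrow> word \<Rightarrow> word" where
  "Iaux c [] = []"
| "Iaux c (X # u) = X # Iaux c u"
| "Iaux c (Y t # u) = Y (c * t) # Iaux (c * t) u"

fun Maux :: "complex \<Rightarrow> word \<Rightarrow> word" where
  "Maux s [] = []"
| "Maux s (X # u) = X # Maux s u"
| "Maux s (Y t # u) = Y (s * t) # u"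

definition psi :: "complex \<Rightarrow> poly \<Rightarrow> poly" where
  "psi s = lin (\<lambda>u. phi (wd (Iaux 1 (Maux s u))))"

text \<open>dr s v' w' computes (rev v') diamond_s (rev w') for words; i.e. the arguments are
  stored reversed so that the head is the final letter.\<close>
fun dr :: "complex \<Rightarrow> word \<Rightarrow> word \<Rightarrow> poly" where
  "dr s [] w = wd (rev w)"
| "dr s v [] = psi s (phi (wd (rev v)))"
| "dr s (X # v) (X # w) = Rm xx (dr s v (X # w)) - Rm xx (dr s (Y 1 # v) w)"
| "dr s (Y a # v) (X # w) =
     (if a = 1 then Rm y (dr s v (X # w)) + Rm xx (dr s (Y 1 # v) w) else 0)"
| "dr s (X # v) (Y t # w) =
     (if t = 1 then Rm xx (dr s v (Y 1 # w)) + Rm y (dr s (X # v) w)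
      else Rm xx (dr s v (Y t # w)) + Rm (yy t) (dr s v (X # w) + dr s v (Y t # w))
           - Rm (yy t) (dr s (Y 1 # v) w))"
| "dr s (Y a # v) (Y t # w) =
     (if a \<noteq> 1 then 0
      else if t = 1 then Rm y (dr s v (Y 1 # w)) - Rm y (dr s (X # v) w)
      else Rm y (dr s v (Y t # w)) - Rm (yy t) (dr s v (X # w) + dr s v (Y t # w))
           + Rm (yy t) (dr s (Y 1 # v) w))"

definition dia :: "complex \<Rightarrow> poly \<Rightarrow> poly \<Rightarrow> poly" where
  "dia s P Q = lin (\<lambda>v. lin (\<lambda>w. dr s (rev v) (rev w)) Q) P"

datatype tree = Node "tree multiset"
type_synonym forest = "tree multiset"

text \<open>B_+ f = Node f; the one-vertex tree is Node {#}; the empty forest is {#}.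
  H is represented by finitely supported functions forest => rat.\<close>

primrec nv :: "tree \<Rightarrow> nat" where
  "nv (Node ts) = 1 + sum_mset (image_mset nv ts)"

definition nvF :: "forest \<Rightarrow> nat" where
  "nvF f = sum_mset (image_mset nv f)"

text \<open>Tensors of forests with natural coefficients are multisets of pairs.\<close>
definition pmulC :: "(forest \<times> forest) multiset \<Rightarrow> (forest \<times> forest) multiset
                       \<Rightarrow> (forest \<times> forest) multiset" where
  "pmulC A B = sum_mset (image_mset (\<lambda>(a1, b1). image_mset (\<lambda>(a2, b2). (a1 + a2, b1 + b2)) B) A)"

primrec cop :: "tree \<Rightarrow> (forest \<times> forest) multiset" where
  "cop (Node ts) = add_mset ({#Node ts#}, {#})
      (image_mset (\<lambda>(a, b). (a, {#Node b#}))
         (fold_mset pmulC {#({#}, {#})#} (image_mset cop ts)))"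

definition copF :: "forest \<Rightarrow> (forest \<times> forest) multiset" where
  "copF f = fold_mset pmulC {#({#}, {#})#} (image_mset cop f)"

text \<open>gen Om f a: the value of tilde f on the letter a, computed from the maps Om of
  forests with fewer vertices (Om g u is tilde g on the word u).  For a tree B_+(g) the
  rules (I),(II) give the values on z (namely 0) and on z_s^delta; letters are expressed
  through x = z_1^delta, y_1 = z - z_1^delta, y_s = z_s^delta - z_1^delta (s ~= 1).
  For a forest of at least two trees, rule (III) with the decomposition f = t * (f - t).\<close>
definition gtree :: "(forest \<Rightarrow> word \<Rightarrow> poly) \<Rightarrow> forest \<Rightarrow> complex \<Rightarrow> poly" where
  "gtree Om g s = (if g = {#} then pmul (zd s) (z - zd s)
     else Rm (z - zd s) (Rm (sm 2 z - zd s) (Rinv (z - zd s) (lin (Om g) (zd s)))))"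

definition gen :: "(forest \<Rightarrow> word \<Rightarrow> poly) \<Rightarrow> forest \<Rightarrow> letter \<Rightarrow> poly" where
  "gen Om f a = (if size f = 1 then
       (let g = (case the_elem (set_mset f) of Node g \<Rightarrow> g) in
        case a of X \<Rightarrow> gtree Om g 1
                | Y s \<Rightarrow> (if s = 1 then 0 - gtree Om g 1 else gtree Om g s - gtree Om g 1))
     else (let t = (SOME t. t \<in># f) in lin (Om {#t#}) (Om (f - {#t#}) [a])))"

text \<open>Word map of a nonempty forest f, on a reversed word (rule (IV)).\<close>
fun Wr :: "(forest \<Rightarrow> word \<Rightarrow> poly) \<Rightarrow> forest \<Rightarrow> word \<Rightarrow> poly" where
  "Wr Om f [] = 0"
| "Wr Om f [a] = gen Om f a"
| "Wr Om f (a # u) =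
     pmul (Wr Om f u) (lt a) + pmul (wd (rev u)) (gen Om f a)
     + sum_mset (image_mset (\<lambda>(f1, f2). pmul (Om f1 (rev u)) (Om f2 [a]))
                   (copF f - {#(f, {#}), ({#}, f)#}))"

fun tmn :: "nat \<Rightarrow> forest \<Rightarrow> word \<Rightarrow> poly" where
  "tmn 0 f u = (if f = {#} then wd u else 0)"
| "tmn (Suc n) f u = (if f = {#} then wd u else Wr (tmn n) f (rev u))"

definition rtmF :: "forest \<Rightarrow> word \<Rightarrow> poly" where
  "rtmF f = tmn (nvF f) f"

definition rtm :: "(forest \<Rightarrow>\<^sub>0 rat) \<Rightarrow> poly \<Rightarrow> poly" where
  "rtm h P = (\<Sum>f\<in>Poly_Mapping.keys h. sm (Poly_Mapping.lookup h f) (lin (rtmF f) P))"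

primrec Ft :: "tree \<Rightarrow> poly" where
  "Ft (Node ts) = (if ts = {#} then y
     else Rm y (Rm (xx + sm 2 y) (Rinv y
            (fold_mset (\<lambda>P Q. dia 1 P Q) onep (image_mset Ft ts)))))"

definition FF :: "forest \<Rightarrow> poly" where
  "FF f = fold_mset (\<lambda>P Q. dia 1 P Q) onep (image_mset Ft f)"

definition FH :: "(forest \<Rightarrow>\<^sub>0 rat) \<Rightarrow> poly" where
  "FH h = (\<Sum>f\<in>Poly_Mapping.keys h. sm (Poly_Mapping.lookup h f) (FF f))"

end

theory Submission
  imports Defs
begin

text \<open>
  In terms of the letters \<open>z\<close>, \<open>y\<close> of the left factor and \<open>z\<close>, \<open>zd t\<close> of the right factor, the
  diamond product is governed by two rules: \<open>z\<close> can be pulled out of either factor on the right, and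
  \<open>vy \<diamond> w zd t = (vy \<diamond> w) zd t + (v \<diamond> w zd t) (z - zd t)\<close>, while \<open>v \<diamond> 1\<close> replaces \<open>x\<close> by \<open>zd s\<close> and
  \<open>y\<close> by \<open>z - zd s\<close>. From these rules \<open>A1\<close> becomes a commutative ring acting on all polynomials, so
  products of forests correspond to iterated diamonds, and the second rule turns the recursion for
  \<open>B_+\<close> of the coproduct into the one for \<open>FF\<close>:
  \<open>FF f \<diamond>_s (w zd t u) = \<Sum> (FF f' \<diamond>_s w) zd t (FF f'' \<diamond>_t u)\<close>. The rooted tree maps satisfy the same
  recursion in the last letter. Uniqueness is the case \<open>s = 1\<close>, \<open>w = 1\<close>, where \<open>F \<diamond>_1 1 = F\<close>.
\<close>

subsection \<open>Noncommutative polynomials as a ring\<close>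

text \<open>With concatenation as addition, \<open>poly\<close> is the monoid algebra of words over
  the rationals, so the ring laws of \<open>poly_mapping\<close> apply to the noncommutative
  product.\<close>

instantiation list :: (type) monoid_add
begin

definition zero_list :: "'a list" where
  "0 = []"

definition plus_list :: "'a list \<Rightarrow> 'a list \<Rightarrow> 'a list" where
  "u + v = u @ v"

instance
  by standard (simp_all add: zero_list_def plus_list_def)

end

abbreviation cst :: "rat \<Rightarrow> poly" where
  "cst c \<equiv> Poly_Mapping.single 0 c"

lemma poly_eq_sum_single:
  "(P :: poly) = (\<Sum>u\<in>Poly_Mapping.keys P. Poly_Mapping.single u (Poly_Mapping.lookup P u))"
proof (rule poly_mapping_eqI)
  fix k
  have "(\<Sum>u\<in>Poly_Mapping.keys P. Poly_Mapping.lookup P u when u = k)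
      = (\<Sum>u\<in>Poly_Mapping.keys P. if u = k then Poly_Mapping.lookup P u else 0)"
    by (rule sum.cong) (auto simp: when_def)
  then show "Poly_Mapping.lookup P k = Poly_Mapping.lookup
      (\<Sum>u\<in>Poly_Mapping.keys P. Poly_Mapping.single u (Poly_Mapping.lookup P u)) k"
    by (simp add: lookup_sum lookup_single in_keys_iff)
qed

lemma pmul_eq_times: "pmul P Q = P * Q"
proof -
  have "P * Q = (\<Sum>u\<in>Poly_Mapping.keys P. Poly_Mapping.single u (Poly_Mapping.lookup P u))
      * (\<Sum>v\<in>Poly_Mapping.keys Q. Poly_Mapping.single v (Poly_Mapping.lookup Q v))"
    by (simp flip: poly_eq_sum_single)
  also have "\<dots> = pmul P Q"
    by (simp add: pmul_def sum_product mult_single plus_list_def)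
  finally show ?thesis ..
qed

lemma onep_eq_one: "onep = 1"
  by (simp add: onep_def wd_def flip: zero_list_def)

lemma wd_Nil: "wd [] = 1"
  using onep_eq_one by (simp add: onep_def)

lemma wd_append: "wd (u @ v) = wd u * wd v"
  by (simp add: wd_def mult_single plus_list_def)

lemma sm_eq_times: "sm c P = cst c * P"
  using mult_map_scale_conv_mult[of c P] by (simp add: sm_def)

lemma Rm_eq_times: "Rm w P = P * w"
  by (simp add: Rm_def pmul_eq_times)

lemma single_eq_cst_times_wd: "Poly_Mapping.single u c = cst c * wd u"
  by (simp add: wd_def mult_single)

lemma times_cst_commute: "P * cst c = cst c * P"
proof -
  have "(\<Sum>u\<in>Poly_Mapping.keys P. Poly_Mapping.single u (Poly_Mapping.lookup P u)) * cst c
      = cst c * (\<Sum>u\<in>Poly_Mapping.keys P. Poly_Mapping.single u (Poly_Mapping.lookup P u))"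
    by (simp add: sum_distrib_left sum_distrib_right mult_single mult.commute)
  then show ?thesis
    by (simp flip: poly_eq_sum_single)
qed

lemma times_cst_left_commute: "P * (cst c * Q) = cst c * (P * Q)"
  by (simp add: times_cst_commute flip: mult.assoc)

lemma cst_minus_one_times: "cst (- 1) * P = - P"
  by (metis mult_minus1 single_one single_uminus)

text \<open>The word case is confined to the support of \<open>P\<close>, so that an assumption such
  as \<open>P \<in> A1\<close> restricts the words to be treated.\<close>

lemma poly_wd_induct [case_names zero wd add scale]:
  assumes "Q 0"
    and "\<And>u. u \<in> Poly_Mapping.keys P \<Longrightarrow> Q (wd u)"
    and "\<And>R S. Q R \<Longrightarrow> Q S \<Longrightarrow> Q (R + S)"
    and "\<And>c R. Q R \<Longrightarrow> Q (cst c * R)"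
  shows "Q (P :: poly)"
proof -
  have "Q (\<Sum>u\<in>A. Poly_Mapping.single u (Poly_Mapping.lookup P u))"
    if "finite A" "A \<subseteq> Poly_Mapping.keys P" for A
    using that
  proof (induction A rule: finite_induct)
    case empty
    then show ?case using assms(1) by simp
  next
    case (insert u A)
    have "Q (Poly_Mapping.single u (Poly_Mapping.lookup P u))"
      using insert.prems assms(2,4) by (subst single_eq_cst_times_wd) simp
    then show ?case
      using insert assms(3) by simp
  qed
  then show ?thesis
    by (metis finite_keys order_refl poly_eq_sum_single)
qed

text \<open>Supports change under addition and scaling; summing over a common larger set makes the
  values of \<open>lin\<close> comparable.\<close>

lemma lin_superset:
  assumes "finite A" "Poly_Mapping.keys P \<subseteq> A"
  shows "lin g P = (\<Sum>u\<in>A. cst (Poly_Mapping.lookup P u) * g u)"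
  unfolding lin_def sm_eq_times
  by (rule sum.mono_neutral_left) (use assms in \<open>auto simp: in_keys_iff\<close>)

lemma lin_zero: "lin g 0 = 0"
  by (simp add: lin_def)

lemma lin_add: "lin g (P + Q) = lin g P + lin g Q"
proof -
  let ?A = "Poly_Mapping.keys P \<union> Poly_Mapping.keys Q"
  have "lin g R = (\<Sum>u\<in>?A. cst (Poly_Mapping.lookup R u) * g u)"
    if "R = P + Q \<or> R = P \<or> R = Q" for R
    using that Poly_Mapping.keys_add[of P Q] by (intro lin_superset) auto
  then show ?thesis
    by (simp add: lookup_add single_add distrib_right sum.distrib)
qed

lemma lookup_cst_times: "Poly_Mapping.lookup (cst c * P) u = c * Poly_Mapping.lookup P u"
proof -
  have "cst c * P = Poly_Mapping.map ((*) c) P"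
    by (simp add: mult_map_scale_conv_mult)
  then show ?thesis
    by (simp add: Poly_Mapping.map.rep_eq when_def)
qed

lemma lin_cst: "lin g (cst c * P) = cst c * lin g P"
proof -
  have "lin g (cst c * P)
      = (\<Sum>u\<in>Poly_Mapping.keys P. cst (Poly_Mapping.lookup (cst c * P) u) * g u)"
    by (rule lin_superset) (auto simp: in_keys_iff lookup_cst_times)
  then show ?thesis
    by (simp add: lin_def sm_eq_times lookup_cst_times sum_distrib_left mult_single flip: mult.assoc)
qed

lemma lin_minus: "lin g (- P) = - lin g P"
  using lin_cst[of g "-1" P] by (simp add: cst_minus_one_times)

lemma lin_diff: "lin g (P - Q) = lin g P - lin g Q"
  using lin_add[of g P "- Q"] by (simp add: lin_minus)

lemma lin_wd: "lin g (wd u) = g u"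
  by (simp add: lin_def wd_def sm_eq_times)

lemma lin_fun_add: "lin (\<lambda>u. g u + h u) P = lin g P + lin h P"
  by (simp add: lin_def sm_eq_times distrib_left sum.distrib)

lemma lin_fun_cst: "lin (\<lambda>u. cst c * g u) P = cst c * lin g P"
  by (simp add: lin_def sm_eq_times sum_distrib_left mult_single mult.commute[of _ c] flip: mult.assoc)

lemma lin_wd_id: "lin wd P = P"
  by (induction P rule: poly_wd_induct) (simp_all add: lin_zero lin_wd lin_add lin_cst)

subsection \<open>The diamond product in the letters z, y and zd t\<close>

lemma wd_snoc: "wd (u @ [a]) = wd u * lt a"
  by (simp add: wd_append lt_def)

lemma zd_eq: "zd s = xx + cst (dl s) * yy s"
  by (simp add: zd_def sm_eq_times)

lemma zd_one: "zd 1 = xx"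
  by (simp add: zd_eq dl_def)

lemma xx_eq: "xx = z - y"
  by (simp add: z_def)

lemma yy_eq: "t \<noteq> 1 \<Longrightarrow> yy t = zd t - zd 1"
  by (simp add: zd_eq dl_def)

text \<open>The elements \<open>z\<close> and \<open>zd t\<close> span the letters: x is
  \<open>zd 1\<close>, y_1 is \<open>z - zd 1\<close>, and y_t is \<open>zd t - zd 1\<close> for
  \<open>t \<noteq> 1\<close>.\<close>

lemma poly_letter_induct [case_names one z zd add scale]:
  assumes one: "Q 1"
    and z: "\<And>w. Q w \<Longrightarrow> Q (w * z)"
    and zd: "\<And>w t. Q w \<Longrightarrow> Q (w * zd t)"
    and add: "\<And>v w. Q v \<Longrightarrow> Q w \<Longrightarrow> Q (v + w)"
    and scale: "\<And>c w. Q w \<Longrightarrow> Q (cst c * w)"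
  shows "Q (w :: poly)"
proof (induction w rule: poly_wd_induct)
  case zero
  show ?case using scale[OF one, of 0] by simp
next
  have diff: "Q (v - w)" if "Q v" "Q w" for v w
    using add[OF that(1) scale[OF that(2), of "- 1"]] by (simp add: cst_minus_one_times)
  case (wd u)
  show ?case
  proof (induction u rule: rev_induct)
    case Nil
    then show ?case using one by (simp add: wd_Nil)
  next
    case (snoc a u)
    have x: "Q (wd u * zd 1)"
      using zd[OF snoc] .
    have "lt a = zd 1 \<or> lt a = z - zd 1 \<or> (\<exists>t. lt a = zd t - zd 1)"
    proof (cases a)
      case X
      then show ?thesis by (simp add: zd_one xx_def)
    next
      case (Y t)
      show ?thesis
        using Y yy_eq[of t]
        by (cases "t = 1") (auto simp: zd_one z_def y_def yy_def xx_def)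
    qed
    then show ?case
      using x diff[OF z[OF snoc] x] diff[OF zd[OF snoc] x]
      by (auto simp: wd_snoc right_diff_distrib)
  qed
qed (fact add scale)+

section \<open>The subspace \<open>A1\<close> and its induction principles\<close>

lemma A1_zero: "0 \<in> A1"
  by (simp add: A1_def)

lemma A1_add: "P \<in> A1 \<Longrightarrow> Q \<in> A1 \<Longrightarrow> P + Q \<in> A1"
  using Poly_Mapping.keys_add[of P Q] by (auto simp: A1_def)

lemma A1_cst: "P \<in> A1 \<Longrightarrow> cst c * P \<in> A1"
  by (auto simp: A1_def in_keys_iff lookup_cst_times)

lemma A1_diff: "P \<in> A1 \<Longrightarrow> Q \<in> A1 \<Longrightarrow> P - Q \<in> A1"
  using A1_add[of P "cst (- 1) * Q"] A1_cst[of Q "- 1"] by (simp add: cst_minus_one_times)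

lemma wd_in_A1_iff: "wd u \<in> A1 \<longleftrightarrow> set u \<subseteq> {X, Y 1}"
  by (simp add: A1_def wd_def)

lemma A1_mult: "P \<in> A1 \<Longrightarrow> Q \<in> A1 \<Longrightarrow> P * Q \<in> A1"
  using Poly_Mapping.keys_mult[of P Q] by (force simp: A1_def plus_list_def)

lemma A1_one: "1 \<in> A1"
  using wd_in_A1_iff[of "[]"] by (simp add: wd_Nil)

lemma A1_xx: "xx \<in> A1" and A1_y: "y \<in> A1"
  by (simp_all add: xx_def y_def yy_def lt_def wd_in_A1_iff)

lemma A1_z: "z \<in> A1"
  by (simp add: z_def A1_add A1_xx A1_y)

lemmas A1_intros = A1_zero A1_add A1_cst A1_diff A1_mult A1_one A1_xx A1_y A1_z

lemma A1_xx_y_induct [consumes 1, case_names one xx y add scale]: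
  assumes v: "v \<in> A1"
    and one: "Q 1"
    and xx: "\<And>v. v \<in> A1 \<Longrightarrow> Q v \<Longrightarrow> Q (v * xx)"
    and y: "\<And>v. v \<in> A1 \<Longrightarrow> Q v \<Longrightarrow> Q (v * y)"
    and add: "\<And>v w. v \<in> A1 \<Longrightarrow> w \<in> A1 \<Longrightarrow> Q v \<Longrightarrow> Q w \<Longrightarrow> Q (v + w)"
    and scale: "\<And>c v. v \<in> A1 \<Longrightarrow> Q v \<Longrightarrow> Q (cst c * v)"
  shows "Q v"
proof -
  have wd: "Q (wd u)" if "set u \<subseteq> {X, Y 1}" for u
    using that
  proof (induction u rule: rev_induct)
    case Nil
    then show ?case using one by (simp add: wd_Nil)
  next
    case (snoc a u)
    then have "Q (wd u)" "wd u \<in> A1" "lt a = xx \<or> lt a = y"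
      by (auto simp: wd_in_A1_iff xx_def y_def yy_def)
    then show ?case
      using xx y by (auto simp: wd_snoc)
  qed
  have "v \<in> A1 \<and> Q v"
  proof (induction v rule: poly_wd_induct)
    case zero
    show ?case using scale[OF A1_one one, of 0] by (simp add: A1_zero)
  next
    case (wd u)
    then have "set u \<subseteq> {X, Y 1}"
      using v by (auto simp: A1_def)
    then show ?case
      using \<open>\<And>u. set u \<subseteq> {X, Y 1} \<Longrightarrow> Q (wd u)\<close> by (simp add: wd_in_A1_iff)
  qed (auto intro: A1_intros add scale)
  then show ?thesis ..
qed

text \<open>Since x is \<open>z - y\<close>, the generators \<open>z\<close> and \<open>y\<close>
  replace \<open>xx\<close> and \<open>y\<close>; in them the rules for the left factor of the
  diamond are simplest.\<close>

lemma A1_z_y_induct [consumes 1, case_names one z y add scale]: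
  assumes v: "v \<in> A1"
    and one: "Q 1"
    and z: "\<And>v. v \<in> A1 \<Longrightarrow> Q v \<Longrightarrow> Q (v * z)"
    and y: "\<And>v. v \<in> A1 \<Longrightarrow> Q v \<Longrightarrow> Q (v * y)"
    and add: "\<And>v w. v \<in> A1 \<Longrightarrow> w \<in> A1 \<Longrightarrow> Q v \<Longrightarrow> Q w \<Longrightarrow> Q (v + w)"
    and scale: "\<And>c v. v \<in> A1 \<Longrightarrow> Q v \<Longrightarrow> Q (cst c * v)"
  shows "Q v"
  using v
proof (induction v rule: A1_xx_y_induct)
  case (xx v)
  have "Q (v * z + cst (- 1) * (v * y))"
    using xx by (intro add scale z y A1_intros)
  then show ?case
    by (simp add: cst_minus_one_times xx_eq right_diff_distrib)
qed (use assms in auto)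

section \<open>The substitutions \<open>phi\<close> and \<open>psi\<close> on
  \<open>A1\<close>\<close>

lemma prodl_append: "prodl (ps @ qs) = prodl ps * prodl qs"
  by (induction ps) (simp_all add: prodl_def pmul_eq_times onep_eq_one mult.assoc)

lemma prodl_single: "prodl [p] = p"
  by (simp add: prodl_def pmul_eq_times onep_eq_one)

lemma phi_wd: "phi (wd u) = prodl (map phil u)"
  by (simp add: phi_def lin_wd)

lemma phi_wd_snoc: "phi (wd (u @ [a])) = phi (wd u) * phil a"
  by (simp add: phi_wd prodl_append prodl_single)

lemma phil_Y: "phil (Y s) = zd s - z"
  by (simp add: zd_eq sm_eq_times z_def)

declare phil.simps(2) [simp del]

lemma phi_wd_in_A1: "set u \<subseteq> {X, Y 1} \<Longrightarrow> phi (wd u) \<in> A1"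
proof (induction u rule: rev_induct)
  case Nil
  then show ?case by (simp add: phi_wd prodl_def onep_eq_one A1_one)
next
  case (snoc a u)
  then show ?case
    by (auto simp: phi_wd_snoc phil_Y zd_one intro!: A1_intros)
qed

text \<open>All indices in the word are 1, so the running product in \<open>Iaux\<close> stays
  \<open>s\<close>: every y_1 turns into y_s, which \<open>phil\<close> sends to
  \<open>zd s - z\<close>.\<close>

lemma prodl_phil_Iaux:
  "set u \<subseteq> {X, Y 1} \<Longrightarrow>
    prodl (map phil (Iaux s u)) = prodl (map (\<lambda>a. if a = X then z else zd s - z) u)"
  by (induction u) (auto simp: prodl_def pmul_eq_times phil_Y)

text \<open>\<open>Maux\<close> marks only the first y with \<open>s\<close>; from there
  \<open>Iaux\<close> carries \<open>s\<close> to all later ones.\<close>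

lemma phi_Iaux_Maux:
  "set u \<subseteq> {X, Y 1} \<Longrightarrow>
    phi (wd (Iaux 1 (Maux s u))) = prodl (map (\<lambda>a. if a = X then z else zd s - z) u)"
proof (induction u)
  case (Cons a u)
  then show ?case
    using prodl_phil_Iaux[of u s] by (auto simp: phi_wd prodl_def pmul_eq_times phil_Y)
qed (simp add: phi_wd)

lemma psi_add: "psi s (P + Q) = psi s P + psi s Q"
  and psi_cst: "psi s (cst c * P) = cst c * psi s P"
  by (simp_all add: psi_def lin_add lin_cst)

text \<open>On \<open>A1\<close> the map \<open>psi s\<close> is the algebra homomorphism with x to
  \<open>z\<close> and y to \<open>zd s - z\<close>.\<close>

lemma psi_times_letter:
  assumes "P \<in> A1"
  shows "psi s (P * xx) = psi s P * z" and "psi s (P * y) = psi s P * (zd s - z)"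
proof -
  have wd: "psi s (wd u) = prodl (map (\<lambda>a. if a = X then z else zd s - z) u)"
    if "set u \<subseteq> {X, Y 1}" for u
    using phi_Iaux_Maux[OF that] by (simp add: psi_def lin_wd)
  have "psi s (P * xx) = psi s P * z \<and> psi s (P * y) = psi s P * (zd s - z)"
  proof (induction P rule: poly_wd_induct)
    case zero
    show ?case by (simp add: psi_def lin_zero)
  next
    case (wd u)
    then have u: "set u \<subseteq> {X, Y 1}"
      using assms by (auto simp: A1_def)
    then show ?case
      using \<open>\<And>u. set u \<subseteq> {X, Y 1} \<Longrightarrow> psi s (wd u) = _ u\<close>[of "u @ [X]"]
        \<open>\<And>u. set u \<subseteq> {X, Y 1} \<Longrightarrow> psi s (wd u) = _ u\<close>[of "u @ [Y 1]"]
        \<open>\<And>u. set u \<subseteq> {X, Y 1} \<Longrightarrow> psi s (wd u) = _ u\<close>[of u]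
      by (simp add: wd_snoc prodl_append prodl_single xx_def y_def yy_def)
  qed (simp_all add: psi_add psi_cst distrib_right mult.assoc)
  then show "psi s (P * xx) = psi s P * z" "psi s (P * y) = psi s P * (zd s - z)"
    by simp_all
qed

text \<open>\<open>phi\<close> sends x to \<open>xx + y\<close> and y to \<open>- y\<close>;
  applying \<open>psi s\<close> gives \<open>z + (zd s - z) = zd s\<close> and
  \<open>z - zd s\<close>.\<close>

lemma psi_phi_snoc:
  assumes "set u \<subseteq> {X, Y 1}"
  shows "psi s (phi (wd (u @ [X]))) = psi s (phi (wd u)) * zd s"
    and "psi s (phi (wd (u @ [Y 1]))) = psi s (phi (wd u)) * (z - zd s)"
proof -
  let ?P = "phi (wd u)"
  note P = psi_times_letter[OF phi_wd_in_A1[OF assms], of s]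
  have "psi s (?P * z) = psi s ?P * zd s"
    using P by (simp add: z_def distrib_left psi_add algebra_simps)
  then show "psi s (phi (wd (u @ [X]))) = psi s ?P * zd s"
    by (simp add: phi_wd_snoc)
  have "psi s (?P * (xx - z)) = psi s ?P * (z - zd s)"
    using P psi_cst[of s "- 1"] by (simp add: cst_minus_one_times z_def algebra_simps)
  then show "psi s (phi (wd (u @ [Y 1]))) = psi s ?P * (z - zd s)"
    by (simp add: phi_wd_snoc phil_Y zd_one)
qed

lemma psi_phi_Nil: "psi s (phi (wd [])) = 1"
proof -
  have "phi (wd []) = wd []"
    by (simp add: phi_wd prodl_def onep_def)
  then show ?thesis
    by (simp add: psi_def lin_wd) (simp add: wd_Nil)
qed

section \<open>Rules for the diamond product of words\<close>

lemma dr_Nil_left: "dr s [] w = wd (rev w)"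
  by (cases w) simp_all

lemma dr_Nil_right: "dr s v [] = psi s (phi (wd (rev v)))"
  using psi_phi_Nil[of s] by (cases v) (simp_all add: wd_Nil)

lemma dr_X_Nil: "set v \<subseteq> {X, Y 1} \<Longrightarrow> dr s (X # v) [] = dr s v [] * zd s"
  and dr_Y_Nil: "set v \<subseteq> {X, Y 1} \<Longrightarrow> dr s (Y 1 # v) [] = dr s v [] * (z - zd s)"
  using psi_phi_snoc[of "rev v" s] by (simp_all add: dr_Nil_right del: dr.simps)

text \<open>The correction terms in the clauses for vx and vy combine to zero in every case; for
  empty \<open>w\<close> the factors \<open>zd s\<close> and \<open>z - zd s\<close> add up to
  \<open>z\<close>.\<close>

lemma dr_z_left:
  assumes "set v \<subseteq> {X, Y 1}"
  shows "dr s (X # v) w + dr s (Y 1 # v) w = dr s v w * z"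
proof (cases w)
  case Nil
  then show ?thesis
    using assms by (simp add: dr_X_Nil dr_Y_Nil algebra_simps del: dr.simps)
next
  case (Cons a u)
  then show ?thesis
    by (cases a) (auto simp: Rm_eq_times z_def y_def algebra_simps)
qed

lemma dr_z_right:
  assumes "set v \<subseteq> {X, Y 1}"
  shows "dr s v (X # w) + dr s v (Y 1 # w) = dr s v w * z"
  using assms
proof (induction v)
  case Nil
  then show ?case
    by (simp add: dr_Nil_left wd_snoc z_def xx_def y_def yy_def distrib_left)
next
  case (Cons a v)
  have IH: "dr s v (X # w) = dr s v w * z - dr s v (Y 1 # w)"
    using Cons by (simp add: eq_diff_eq)
  have zl: "dr s (X # v) w = dr s v w * z - dr s (Y 1 # v) w"
    using dr_z_left[of v s w] Cons by (simp add: eq_diff_eq)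
  show ?case
  proof (cases "a = X")
    case True
    then show ?thesis
      by (simp add: Rm_eq_times IH zl) (simp add: z_def algebra_simps)
  next
    case False
    then have "a = Y 1" using Cons by auto
    then show ?thesis
      by (simp add: Rm_eq_times IH zl) (simp add: z_def algebra_simps)
  qed
qed

text \<open>Adding the clauses for wx and wy_t collects the remaining terms into the factor
  \<open>z - zd t\<close>, which is \<open>y - yy t\<close> for \<open>t \<noteq> 1\<close> and
  \<open>y\<close> for \<open>t = 1\<close>.\<close>

lemma dr_Y_zd:
  "dr s (Y 1 # v) (X # w) + cst (dl t) * dr s (Y 1 # v) (Y t # w)
    = dr s (Y 1 # v) w * zd t + (dr s v (X # w) + cst (dl t) * dr s v (Y t # w)) * (z - zd t)"
  by (cases "t = 1") (simp_all add: Rm_eq_times zd_eq dl_def z_def algebra_simps)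

section \<open>Bilinear extension of the word rules\<close>

lemma dia_wd: "dia s (wd v) (wd w) = dr s (rev v) (rev w)"
  by (simp add: dia_def lin_wd)

lemma dia_add_left: "dia s (P + P') Q = dia s P Q + dia s P' Q"
  and dia_diff_left: "dia s (P - P') Q = dia s P Q - dia s P' Q"
  and dia_cst_left: "dia s (cst c * P) Q = cst c * dia s P Q"
  and dia_zero_left: "dia s 0 Q = 0"
  by (simp_all add: dia_def lin_add lin_diff lin_cst lin_zero)

lemma dia_add_right: "dia s P (Q + Q') = dia s P Q + dia s P Q'"
  and dia_cst_right: "dia s P (cst c * Q) = cst c * dia s P Q"
  by (simp_all add: dia_def lin_add lin_fun_add lin_cst lin_fun_cst)

lemma dia_zero_right: "dia s P 0 = 0"
  using dia_cst_right[of s P 0 0] by simp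

lemma dia_diff_right: "dia s P (Q - Q') = dia s P Q - dia s P Q'"
  using dia_add_right[of s P Q "- Q'"] dia_cst_right[of s P "- 1" Q']
  by (simp add: cst_minus_one_times)

lemma dia_one_left: "dia s 1 w = w"
proof -
  have "dia s (wd []) w = w"
    using lin_wd_id[of w] by (simp add: dia_def lin_wd dr_Nil_left)
  then show ?thesis
    by (simp add: wd_Nil)
qed

text \<open>Reduces a bilinear identity to pairs of words, the left one in the letters x and y_1
  only.\<close>

lemma A1_bilinear_ext:
  assumes "v \<in> A1"
    and "\<And>u w. set u \<subseteq> {X, Y 1} \<Longrightarrow> E (wd u) (wd w)"
    and "\<And>v. E v 0" and "\<And>w. E 0 w"
    and "\<And>v v' w. E v w \<Longrightarrow> E v' w \<Longrightarrow> E (v + v') w"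
    and "\<And>c v w. E v w \<Longrightarrow> E (cst c * v) w"
    and "\<And>v w w'. E v w \<Longrightarrow> E v w' \<Longrightarrow> E v (w + w')"
    and "\<And>c v w. E v w \<Longrightarrow> E v (cst c * w)"
  shows "E v (w :: poly)"
proof (induction v rule: poly_wd_induct)
  case (wd u)
  then have "set u \<subseteq> {X, Y 1}"
    using assms(1) by (auto simp: A1_def)
  then show ?case
    by (induction w rule: poly_wd_induct) (use assms in auto)
qed (use assms in auto)

lemmas dia_linear = dia_add_left dia_diff_left dia_cst_left dia_zero_left
  dia_add_right dia_diff_right dia_cst_right dia_zero_right

lemma dia_z_left:
  assumes "v \<in> A1"
  shows "dia s (v * z) w = dia s v w * z"
proof (rule A1_bilinear_ext[OF assms, where E = "\<lambda>v w. dia s (v * z) w = dia s v w * z"])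
  fix u w assume u: "set u \<subseteq> {X, Y 1}"
  have "wd u * z = wd (u @ [X]) + wd (u @ [Y 1])"
    by (simp add: wd_snoc z_def xx_def y_def yy_def distrib_left)
  then show "dia s (wd u * z) (wd w) = dia s (wd u) (wd w) * z"
    using dr_z_left[of "rev u" s "rev w"] u by (simp add: dia_wd dia_add_left del: dr.simps)
qed (simp_all add: dia_linear distrib_right mult.assoc)

lemma dia_z_right:
  assumes "v \<in> A1"
  shows "dia s v (w * z) = dia s v w * z"
proof (rule A1_bilinear_ext[OF assms, where E = "\<lambda>v w. dia s v (w * z) = dia s v w * z"])
  fix u w assume u: "set u \<subseteq> {X, Y 1}"
  have "wd w * z = wd (w @ [X]) + wd (w @ [Y 1])"
    by (simp add: wd_snoc z_def xx_def y_def yy_def distrib_left)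
  then show "dia s (wd u) (wd w * z) = dia s (wd u) (wd w) * z"
    using dr_z_right[of "rev u" s "rev w"] u by (simp add: dia_wd dia_add_right del: dr.simps)
qed (simp_all add: dia_linear distrib_right mult.assoc)

lemma dia_y_one:
  assumes "v \<in> A1"
  shows "dia s (v * y) 1 = dia s v 1 * (z - zd s)"
proof (induction v rule: poly_wd_induct)
  case (wd u)
  then have u: "set u \<subseteq> {X, Y 1}"
    using assms by (auto simp: A1_def)
  have "dia s (wd u * y) (wd []) = dia s (wd u) (wd []) * (z - zd s)"
    using dr_Y_Nil[of "rev u" s] u wd_snoc[of u "Y 1"]
    by (simp add: dia_wd y_def yy_def del: dr.simps flip: wd_snoc)
  then show ?case
    by (simp add: wd_Nil)
qed (simp_all add: dia_linear distrib_right mult.assoc)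

lemma dia_y_zd:
  assumes "v \<in> A1"
  shows "dia s (v * y) (w * zd t) = dia s (v * y) w * zd t + dia s v (w * zd t) * (z - zd t)"
proof (rule A1_bilinear_ext[OF assms, where E = "\<lambda>v w. dia s (v * y) (w * zd t)
    = dia s (v * y) w * zd t + dia s v (w * zd t) * (z - zd t)"])
  fix u w assume u: "set u \<subseteq> {X, Y 1}"
  have w: "wd w * zd t = wd (w @ [X]) + cst (dl t) * wd (w @ [Y t])"
    by (simp add: wd_snoc zd_eq xx_def yy_def distrib_left times_cst_left_commute)
  have "wd u * y = wd (u @ [Y 1])"
    by (simp add: wd_snoc y_def yy_def)
  then show "dia s (wd u * y) (wd w * zd t)
      = dia s (wd u * y) (wd w) * zd t + dia s (wd u) (wd w * zd t) * (z - zd t)"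
    using dr_Y_zd[of s "rev u" "rev w" t]
    by (simp add: w dia_wd dia_add_right dia_cst_right del: dr.simps)
qed (simp_all add: dia_linear distrib_right distrib_left mult.assoc)

subsection \<open>The diamond action of A1\<close>

lemma z_minus_zd_one: "z - zd 1 = y"
  by (simp add: zd_one z_def)

text \<open>For \<open>s = 1\<close> the substitution of \<open>zd s\<close> for x and
  \<open>z - zd s\<close> for y is the identity.\<close>

lemma dia_one_right:
  assumes "v \<in> A1"
  shows "dia 1 v 1 = v"
  using assms
  by (induction v rule: A1_z_y_induct)
    (simp_all add: dia_one_left dia_z_left dia_y_one z_minus_zd_one dia_linear)

text \<open>The case \<open>t = 1\<close> of \<open>dia_y_zd\<close>, with \<open>zd 1\<close>
  expressed as \<open>z - y\<close>. The shape of the right side is preserved when the roles of the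
  two factors are exchanged, which yields commutativity.\<close>

lemma dia_y_y:
  assumes "a \<in> A1"
  shows "dia 1 (a * y) (b * y) = (dia 1 (a * y) b + dia 1 a (b * y) - dia 1 a b * z) * y"
proof -
  have b: "b * y = b * z - b * zd 1"
    by (simp flip: z_minus_zd_one right_diff_distrib)
  have "dia 1 (a * y) (b * y) = dia 1 (a * y) b * (z - zd 1) - dia 1 a (b * zd 1) * (z - zd 1)"
    using assms by (simp add: b dia_diff_right dia_z_right dia_y_zd A1_intros right_diff_distrib)
  moreover have "dia 1 a (b * zd 1) = dia 1 a b * z - dia 1 a (b * y)"
    using assms by (simp add: b dia_diff_right dia_z_right)
  ultimately show ?thesis
    by (simp add: z_minus_zd_one algebra_simps)
qed

lemma A1_dia:
  assumes "v \<in> A1" "w \<in> A1"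
  shows "dia 1 v w \<in> A1"
  using assms
proof (induction v arbitrary: w rule: A1_z_y_induct)
  case (y v)
  from y.prems show ?case
  proof (induction w rule: A1_z_y_induct)
    case one
    then show ?case using y by (simp add: dia_one_right A1_intros)
  next
    case (y w)
    with \<open>v \<in> A1\<close> show ?case
      using \<open>\<And>w. w \<in> A1 \<Longrightarrow> dia 1 v w \<in> A1\<close> by (simp add: dia_y_y A1_intros)
  qed (use y in \<open>simp_all add: dia_z_right dia_linear A1_intros\<close>)
qed (simp_all add: dia_one_left dia_z_left dia_linear A1_intros)

lemma dia_commute:
  assumes "v \<in> A1" "w \<in> A1"
  shows "dia 1 v w = dia 1 w v"
  using assms
proof (induction v arbitrary: w rule: A1_z_y_induct)
  case one
  then show ?case by (simp add: dia_one_left dia_one_right)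
next
  case (z v)
  then show ?case by (simp add: dia_z_left dia_z_right)
next
  case (y v)
  from y.prems show ?case
  proof (induction w rule: A1_z_y_induct)
    case one
    then show ?case using y by (simp add: dia_one_left dia_one_right A1_intros)
  next
    case (y w)
    with \<open>v \<in> A1\<close> show ?case
      using \<open>\<And>w. w \<in> A1 \<Longrightarrow> dia 1 v w = dia 1 w v\<close>
      by (simp add: dia_y_y A1_intros add.commute)
  qed (use y in \<open>simp_all add: dia_z_right dia_z_left dia_linear A1_intros\<close>)
qed (simp_all add: dia_linear)

text \<open>For \<open>v = ay\<close> and \<open>v' = by\<close> both sides reduce to the expression \<open>?E\<close>, symmetric in \<open>a\<close> and \<open>b\<close>,
  that governs the product of \<open>ay\<close> and \<open>by\<close> in \<open>A1\<close>.\<close>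

lemma dia_assoc:
  assumes "v \<in> A1" "v' \<in> A1"
  shows "dia s v (dia s v' w) = dia s (dia 1 v v') w"
  using assms
proof (induction v arbitrary: v' w rule: A1_z_y_induct)
  case one
  then show ?case by (simp add: dia_one_left)
next
  case (z v)
  then show ?case by (simp add: dia_z_left A1_dia)
next
  case (y a)
  note a = \<open>a \<in> A1\<close> and IHa = y.IH
  have ay: "a * y \<in> A1"
    using a by (simp add: A1_intros)
  from y.prems show ?case
  proof (induction v' arbitrary: w rule: A1_z_y_induct)
    case one
    then show ?case using ay by (simp add: dia_one_left dia_one_right)
  next
    case (z b)
    then show ?case using ay by (simp add: dia_z_left dia_z_right A1_dia)
  next
    case (y b)
    note b = \<open>b \<in> A1\<close> and IHb = y.IH
    have by': "b * y \<in> A1"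
      using b by (simp add: A1_intros)
    let ?E = "dia 1 (a * y) b + dia 1 a (b * y) - dia 1 a b * z"
    have E: "?E \<in> A1"
      using a b ay by' by (intro A1_intros A1_dia)
    \<comment> \<open>The outer hypothesis covers the left factor \<open>a\<close>, the inner one
      the right factor \<open>b\<close>; together they treat each of the three terms of
      \<open>?E\<close>.\<close>
    have dia_E: "dia s ?E u
        = dia s (a * y) (dia s b u) + dia s a (dia s (b * y) u) - dia s a (dia s b u) * z" for u
      using IHa[OF b, of u] IHa[OF by', of u] IHb[of u] a b
      by (simp add: dia_linear dia_z_left A1_dia)
    have yE: "dia 1 (a * y) (b * y) = ?E * y"
      using a by (rule dia_y_y)
    show ?case
    proof (induction w rule: poly_letter_induct)
      case one
      let ?B = "dia s b 1"
      have zd: "?B * zd s = ?B * z - dia s (b * y) 1"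
        using b by (simp add: dia_y_one right_diff_distrib)
      have "dia s (a * y) (dia s (b * y) 1)
          = dia s (a * y) ?B * (z - zd s) - dia s a (?B * zd s) * (z - zd s)"
        using a b ay
        by (simp add: dia_y_one right_diff_distrib dia_diff_right dia_z_right dia_y_zd)
      also have "\<dots> = dia s ?E 1 * (z - zd s)"
        unfolding dia_E zd using a by (simp add: dia_diff_right dia_z_right algebra_simps)
      finally show ?case
        using E by (simp add: yE dia_y_one)
    next
      case (z c)
      then show ?case using ay by' by (simp add: dia_z_right A1_dia)
    next
      case (zd c t)
      let ?B = "dia s b (c * zd t)"
      \<comment> \<open>Trading \<open>zd t\<close> for \<open>z\<close>, which leaves any right
        factor, reduces the inner diamonds to those occurring in \<open>dia_E\<close>.\<close>
      have zd': "dia s (b * y) c * zd t = dia s (b * y) (c * zd t) - ?B * (z - zd t)"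
        using b by (simp add: dia_y_zd)
      have "dia s (a * y) (dia s (b * y) (c * zd t))
          = dia s (a * y) (dia s (b * y) c * zd t) + dia s (a * y) (?B * (z - zd t))"
        using b by (simp add: dia_y_zd dia_add_right)
      also have "\<dots> = dia s (a * y) (dia s (b * y) c) * zd t
          + dia s a (dia s (b * y) c * zd t) * (z - zd t)
          + dia s (a * y) ?B * (z - zd t) - dia s a (?B * zd t) * (z - zd t)"
        using a ay by (simp add: right_diff_distrib dia_diff_right dia_z_right dia_y_zd)
      also have "\<dots> = dia s (a * y) (dia s (b * y) c) * zd t + dia s ?E (c * zd t) * (z - zd t)"
        unfolding dia_E zd' using a
        by (simp add: right_diff_distrib dia_diff_right dia_z_right) (simp add: algebra_simps)
      finally show ?case
        using E zd by (simp add: yE dia_y_zd)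
    qed (simp_all add: dia_linear)
  qed (simp_all add: dia_linear)
qed (simp_all add: dia_linear)

section \<open>Cancellation and removal of final factors\<close>

lemma lookup_times_letter:
  "Poly_Mapping.lookup (v * lt a) (u @ [b]) = (if a = b then Poly_Mapping.lookup v u else 0)"
proof (induction v rule: poly_wd_induct)
  case (wd w)
  then show ?case
    by (simp flip: wd_snoc) (simp add: wd_def lookup_single when_def)
qed (simp_all add: distrib_right lookup_add mult.assoc lookup_cst_times)

lemma lookup_letter_times: "Poly_Mapping.lookup (lt a * v) (a # u) = Poly_Mapping.lookup v u"
proof (induction v rule: poly_wd_induct)
  case (wd w)
  then show ?case
    by (simp add: lt_def flip: wd_append) (simp add: wd_def lookup_single when_def)
qed (simp_all add: distrib_left lookup_add times_cst_left_commute lookup_cst_times)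

lemma xx_left_cancel:
  assumes "xx * v = xx * w"
  shows "v = w"
  by (rule poly_mapping_eqI) (metis assms lookup_letter_times xx_def)

text \<open>The coefficient at \<open>u @ [Y 1]\<close> recovers the one at \<open>u\<close>:
  \<open>z - zd s\<close> is \<open>y - yy s\<close> for \<open>s \<noteq> 1\<close> and
  \<open>y\<close> for \<open>s = 1\<close>, so only its term \<open>y\<close> contributes.\<close>

lemma times_z_minus_zd_cancel:
  assumes "v * (z - zd s) = w * (z - zd s)"
  shows "v = w"
proof (rule poly_mapping_eqI)
  fix u
  have zs: "p * (z - zd s) = p * lt (Y 1) - cst (dl s) * (p * lt (Y s))" for p
    by (simp add: z_def zd_eq y_def yy_def right_diff_distrib times_cst_left_commute)
  have "Poly_Mapping.lookup (p * (z - zd s)) (u @ [Y 1]) = Poly_Mapping.lookup p u" for p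
    by (simp add: zs lookup_minus lookup_cst_times lookup_times_letter dl_def)
  then show "Poly_Mapping.lookup v u = Poly_Mapping.lookup w u"
    using assms by metis
qed

lemma Rinv_times: "Rinv (z - zd s) (v * (z - zd s)) = v"
  unfolding Rinv_def pmul_eq_times
  by (rule the_equality) (auto dest: times_z_minus_zd_cancel)

lemma Rinv_y_times: "Rinv y (v * y) = v"
  using Rinv_times[of 1] by (simp add: z_minus_zd_one)

section \<open>The polynomials of trees and forests\<close>

abbreviation dias :: "poly multiset \<Rightarrow> poly" where
  "dias M \<equiv> fold_mset (\<lambda>P Q. dia 1 P Q) onep M"

lemma dias_add_mset:
  assumes "P \<in> A1" "set_mset M \<subseteq> A1"
  shows "dias (add_mset P M) = dia 1 P (dias M)"
proof -
  \<comment> \<open>Commutation is known for factors in \<open>A1\<close>; letting all others act as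
    the identity gives a globally commuting function that folds alike over \<open>M\<close>.\<close>
  let ?g = "\<lambda>P. if P \<in> A1 then dia 1 P else id"
  have left_comm: "dia 1 P (dia 1 Q w) = dia 1 Q (dia 1 P w)" if "P \<in> A1" "Q \<in> A1" for P Q w
    using that by (simp add: dia_assoc dia_commute)
  interpret g: comp_fun_commute ?g
    by standard (auto simp: fun_eq_iff left_comm)
  interpret d: comp_fun_commute_on A1 "dia 1"
    by standard (auto simp: fun_eq_iff left_comm)
  have eq: "fold_mset (dia 1) s M = fold_mset ?g s M" if "set_mset M \<subseteq> A1" for s M
    unfolding fold_mset_def
  proof (rule Finite_Set.fold_cong)
    show "comp_fun_commute_on A1 (\<lambda>x. dia 1 x ^^ count M x)"
      by (rule d.comp_fun_commute_on_funpow)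
    show "comp_fun_commute_on A1 (\<lambda>x. ?g x ^^ count M x)"
      by standard (rule comp_fun_commute.comp_fun_commute[OF g.comp_fun_commute_funpow])
  qed (use that in auto)
  show ?thesis
    using eq[of M] eq[of "add_mset P M"] assms by simp
qed

text \<open>By \<open>dia_y_y\<close> the multiples of \<open>y\<close> are closed under the
  product, so a nonempty product has a final \<open>y\<close> for \<open>Rinv y\<close> to
  remove.\<close>

lemma dias_times_y:
  assumes "\<forall>P\<in>#M. \<exists>v\<in>A1. P = v * y"
  shows "M = {#} \<or> (\<exists>v\<in>A1. dias M = v * y)"
  using assms
proof (induction M)
  case (add P M)
  then obtain v where v: "v \<in> A1" "P = v * y"
    by auto
  have M: "set_mset M \<subseteq> A1"
    using add.prems by (auto dest!: bspec simp: A1_intros)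
  have dias: "dias (add_mset P M) = dia 1 (v * y) (dias M)"
    using v M by (simp add: dias_add_mset A1_intros)
  show ?case
  proof (cases "M = {#}")
    case True
    then show ?thesis
      using v by (auto simp: onep_eq_one dia_one_right A1_intros)
  next
    case False
    then obtain b where b: "b \<in> A1" "dias M = b * y"
      using add by auto
    have "dia 1 (v * y) b + dia 1 v (b * y) - dia 1 v b * z \<in> A1"
      using v b by (intro A1_intros A1_dia)
    then show ?thesis
      using v b dias dia_y_y[of v b] by auto
  qed
qed simp

lemma FF_Nil: "FF {#} = 1"
  by (simp add: FF_def onep_eq_one)

text \<open>Since \<open>xx + sm 2 y\<close> equals \<open>z + y\<close>, the recursion takes a form
  to which the rules for final \<open>z\<close> and \<open>y\<close> apply.\<close>

lemma Ft_Node_eq: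
  assumes "ts \<noteq> {#}" "FF ts = v * y"
  shows "Ft (Node ts) = (v * z + FF ts) * y"
proof -
  have "sm 2 y = y + y"
    by (simp add: sm_eq_times mult_2)
  moreover have "Rinv y (FF ts) = v"
    using assms(2) by (simp add: Rinv_y_times)
  ultimately show ?thesis
    using assms by (simp add: FF_def[symmetric] Rm_eq_times z_def algebra_simps)
qed

lemma Ft_times_y: "\<exists>v\<in>A1. Ft t = v * y"
proof (induction t)
  case (Node ts)
  show ?case
  proof (cases "ts = {#}")
    case True
    then show ?thesis by (auto intro!: bexI[of _ 1] A1_intros)
  next
    case False
    then obtain v where "v \<in> A1" "FF ts = v * y"
      using dias_times_y[of "image_mset Ft ts"] Node by (auto simp: FF_def)
    then show ?thesis
      using Ft_Node_eq[OF False] by (metis A1_add A1_mult A1_y A1_z)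
  qed
qed

lemma FF_times_y: "f \<noteq> {#} \<Longrightarrow> \<exists>v\<in>A1. FF f = v * y"
  using dias_times_y[of "image_mset Ft f"] Ft_times_y by (auto simp: FF_def)

lemma A1_Ft: "Ft t \<in> A1"
  using Ft_times_y[of t] by (auto simp: A1_intros)

lemma A1_FF: "FF f \<in> A1"
  using FF_times_y[of f] by (cases "f = {#}") (auto simp: FF_Nil A1_intros)

lemma FF_add_mset: "FF (add_mset t f) = dia 1 (Ft t) (FF f)"
  using dias_add_mset[of "Ft t" "image_mset Ft f"] A1_Ft by (auto simp: FF_def)

lemma FF_single: "FF {#t#} = Ft t"
  by (simp add: FF_add_mset FF_Nil dia_one_right A1_Ft)

lemma FF_add: "FF (f + g) = dia 1 (FF f) (FF g)"
proof (induction f)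
  case (add t f)
  then show ?case
    by (simp add: FF_add_mset dia_assoc A1_Ft A1_FF)
qed (simp add: FF_Nil dia_one_left)

section \<open>The coproduct and its extreme terms\<close>

lemma pmulC_empty_left: "pmulC {#} B = {#}"
  by (simp add: pmulC_def)

lemma pmulC_add_mset_left:
  "pmulC (add_mset p A) B = image_mset (\<lambda>q. (fst p + fst q, snd p + snd q)) B + pmulC A B"
  by (simp add: pmulC_def case_prod_unfold)

lemma pmulC_union_right: "pmulC A (B + C) = pmulC A B + pmulC A C"
  by (induction A) (simp_all add: pmulC_empty_left pmulC_add_mset_left ac_simps)

lemma image_pmulC:
  "image_mset (\<lambda>q. (fst p + fst q, snd p + snd q)) (pmulC A B)
    = pmulC A (image_mset (\<lambda>q. (fst p + fst q, snd p + snd q)) B)"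
  by (induction A)
    (simp_all add: pmulC_empty_left pmulC_add_mset_left multiset.map_comp comp_def add.left_commute)

lemma pmulC_left_commute: "pmulC A (pmulC B C) = pmulC B (pmulC A C)"
proof (induction A)
  case empty
  show ?case by (induction B) (simp_all add: pmulC_empty_left pmulC_add_mset_left)
next
  case (add p A)
  then show ?case by (simp add: pmulC_add_mset_left pmulC_union_right image_pmulC)
qed

lemma copF_Nil: "copF {#} = {#({#}, {#})#}"
  by (simp add: copF_def)

lemma copF_add_mset: "copF (add_mset t f) = pmulC (cop t) (copF f)"
proof -
  interpret comp_fun_commute pmulC
    by standard (simp add: fun_eq_iff pmulC_left_commute)
  show ?thesis
    by (simp add: copF_def)
qed

lemma cop_Node:
  "cop (Node f) = add_mset ({#Node f#}, {#}) (image_mset (\<lambda>p. (fst p, {#Node (snd p)#})) (copF f))"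
  by (simp add: copF_def case_prod_unfold)

declare cop.simps [simp del] Ft.simps [simp del]

lemma sum_pmulC:
  "(\<Sum>p\<in>#pmulC A B. h (fst p) (snd p))
    = (\<Sum>p\<in>#A. \<Sum>q\<in>#B. h (fst p + fst q) (snd p + snd q))"
  by (induction A)
    (simp_all add: pmulC_empty_left pmulC_add_mset_left multiset.map_comp comp_def)

text \<open>Used for the emptiness of one component: a sum of forests is empty exactly if both
  summands are.\<close>

lemma filter_pmulC:
  assumes "\<And>p q. P (fst p + fst q, snd p + snd q) \<longleftrightarrow> P p \<and> P q"
  shows "filter_mset P (pmulC A B) = pmulC (filter_mset P A) (filter_mset P B)"
proof (induction A)
  case (add p A)
  have "filter_mset P (image_mset (\<lambda>q. (fst p + fst q, snd p + snd q)) B)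
      = (if P p then image_mset (\<lambda>q. (fst p + fst q, snd p + snd q)) (filter_mset P B) else {#})"
    by (induction B) (auto simp: assms)
  then show ?case
    using add by (simp add: pmulC_add_mset_left)
qed (simp add: pmulC_empty_left)

lemma pmulC_single: "pmulC {#p#} {#q#} = {#(fst p + fst q, snd p + snd q)#}"
  by (simp add: pmulC_add_mset_left pmulC_empty_left)

text \<open>Grafting makes the right component nonempty, so a tree contributes only the added term
  \<open>({#t#}, {#})\<close>; \<open>filter_pmulC\<close> passes to forests.\<close>

lemma filter_snd_copF: "filter_mset (\<lambda>p. snd p = {#}) (copF f) = {#(f, {#})#}"
proof (induction f)
  case (add t f)
  have "filter_mset (\<lambda>p. snd p = {#}) (cop t) = {#({#t#}, {#})#}"
  proof (cases t)
    case (Node g)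
    then show ?thesis by (simp add: cop_Node filter_mset_image_mset)
  qed
  then show ?case
    using add by (simp add: copF_add_mset filter_pmulC pmulC_single)
qed (simp add: copF_Nil)

text \<open>Grafting keeps left components, so an empty one in \<open>cop (Node g)\<close> stems
  from \<open>({#}, g)\<close> in \<open>copF g\<close>. The inner induction builds that term from
  the trees of \<open>g\<close>.\<close>

lemma filter_fst_cop:
  "filter_mset (\<lambda>p. fst p = {#}) (cop t) = {#({#}, {#t#})#}"
proof (induction t)
  case (Node g)
  have "filter_mset (\<lambda>p. fst p = {#}) (copF g) = {#({#}, g)#}"
    using Node
  proof (induction g)
    case (add t f)
    then show ?case by (simp add: copF_add_mset filter_pmulC pmulC_single)
  qed (simp add: copF_Nil)
  then show ?case
    by (simp add: cop_Node filter_mset_image_mset)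
qed

lemma filter_fst_copF: "filter_mset (\<lambda>p. fst p = {#}) (copF f) = {#({#}, f)#}"
proof (induction f)
  case (add t f)
  then show ?case by (simp add: copF_add_mset filter_pmulC pmulC_single filter_fst_cop)
qed (simp add: copF_Nil)

subsection \<open>Compatibility with the coproduct of rooted forests\<close>

lemma sum_mset_if_filter:
  "(\<Sum>p\<in>#M. if P p then h p else 0) = (\<Sum>p\<in>#filter_mset P M. h p)"
  by (induction M) auto

lemma dia_sum_mset_right: "dia s v (\<Sum>p\<in>#M. h p) = (\<Sum>p\<in>#M. dia s v (h p))"
  by (induction M) (simp_all add: dia_linear)

text \<open>Taking \<open>H {#} = 0\<close> and splitting off the constant term lets the empty
  forest obey the same formulas, with \<open>Ft (Node {#}) = y\<close>.\<close>

lemma FF_root: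
  obtains H where "\<And>h. H h \<in> A1"
    and "\<And>h. FF h = H h * y + cst (if h = {#} then 1 else 0)"
    and "\<And>h. Ft (Node h) = (H h * z + FF h) * y"
proof -
  have "\<exists>v. v \<in> A1 \<and> FF h = v * y + cst (if h = {#} then 1 else 0)
      \<and> Ft (Node h) = (v * z + FF h) * y" for h
  proof (cases "h = {#}")
    case True
    then show ?thesis by (intro exI[of _ 0]) (simp add: FF_Nil Ft.simps A1_zero)
  next
    case False
    then show ?thesis
      using FF_times_y[OF False] Ft_Node_eq[OF False] by auto
  qed
  then show ?thesis
    using that by metis
qed

text \<open>Up to its constant term, \<open>FF g\<close> is \<open>H g * y\<close>, and the recursion for \<open>B_+\<close> inserts a letter before
  the final \<open>y\<close>. So the formula assumed for \<open>FF g\<close> is needed for \<open>H g\<close>; it follows by cancelling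
  \<open>z - zd q\<close> on the right.\<close>

lemma Ft_coproduct:
  assumes g: "\<And>u. dia s (FF g) (w * zd t * u)
      = (\<Sum>p\<in>#copF g. dia s (FF (fst p)) w * zd t * dia t (FF (snd p)) u)"
  shows "dia s (Ft (Node g)) (w * zd t * u) = dia s (Ft (Node g)) w * zd t * u
      + (\<Sum>p\<in>#copF g. dia s (FF (fst p)) w * zd t * dia t (Ft (Node (snd p))) u)"
proof -
  obtain H where H: "\<And>h. H h \<in> A1"
    and FF: "\<And>h. FF h = H h * y + cst (if h = {#} then 1 else 0)"
    and B: "\<And>h. Ft (Node h) = (H h * z + FF h) * y"
    using FF_root by blast
  define D where "D p = dia s (FF (fst p)) w * zd t" for p :: "forest \<times> forest"
  have dia_cst: "dia s' (cst c) v = cst c * v" for s' c v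
    using dia_cst_left[of s' c 1 v] by (simp add: dia_one_left)
  have dia_H: "dia s' (FF h) (v * zd q) = dia s' (H h) (v * zd q) * (z - zd q) + dia s' (FF h) v * zd q"
    for s' h v q
    using H by (simp add: FF dia_add_left dia_y_zd dia_cst distrib_right mult.assoc)
  have dia_B: "dia s' (Ft (Node h)) (v * zd q) = dia s' (Ft (Node h)) v * zd q
      + (dia s' (H h) (v * zd q) * z + dia s' (FF h) (v * zd q)) * (z - zd q)" for s' h v q
    using H[of h] A1_FF[of h] by (simp add: B dia_y_zd dia_z_left dia_add_left A1_intros)
  have dia_H1: "dia s' (FF h) 1 = dia s' (H h) 1 * (z - zd s') + cst (if h = {#} then 1 else 0)"
    for s' h
    using H[of h] by (simp add: FF dia_add_left dia_y_one dia_cst)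
  have dia_B1: "dia s' (Ft (Node h)) 1 = (dia s' (H h) 1 * z + dia s' (FF h) 1) * (z - zd s')"
    for s' h
    using H[of h] A1_FF[of h] by (simp add: B dia_y_one dia_z_left dia_add_left A1_intros)
  have gD: "dia s (FF g) (w * zd t * u) = (\<Sum>p\<in>#copF g. D p * dia t (FF (snd p)) u)" for u
    using g by (simp add: D_def)
  have "dia s (Ft (Node g)) (w * zd t * u) = dia s (Ft (Node g)) w * zd t * u
      + (\<Sum>p\<in>#copF g. D p * dia t (Ft (Node (snd p))) u)"
  proof (induction u rule: poly_letter_induct)
    case one
    \<comment> \<open>The constant term of \<open>FF (snd p)\<close> is nonzero only for the single
      coproduct term with empty right component.\<close>
    have D_Nil: "(\<Sum>p\<in>#copF g. D p * cst (if snd p = {#} then 1 else 0)) = D (g, {#})"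
    proof -
      have "(\<Sum>p\<in>#copF g. D p * cst (if snd p = {#} then 1 else 0))
          = (\<Sum>p\<in>#copF g. if snd p = {#} then D p else 0)"
        by (intro arg_cong[where f = sum_mset] image_mset_cong) simp
      then show ?thesis
        by (simp add: sum_mset_if_filter filter_snd_copF)
    qed
    \<comment> \<open>The same diamond is expanded by the assumed formula and by
      \<open>dia_H\<close>. Both expansions share \<open>D (g, {#})\<close>, so the multiples of
      \<open>z - zd t\<close> agree.\<close>
    have "(\<Sum>p\<in>#copF g. D p * dia t (H (snd p)) 1) * (z - zd t) + D (g, {#})
        = dia s (FF g) (w * zd t)"
      using gD[of 1]
      by (simp add: dia_H1 sum_mset_distrib_right distrib_left sum_mset.distrib D_Nil mult.assoc)
    also have "\<dots> = dia s (H g) (w * zd t) * (z - zd t) + D (g, {#})"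
      by (simp add: dia_H D_def)
    finally have "dia s (H g) (w * zd t) = (\<Sum>p\<in>#copF g. D p * dia t (H (snd p)) 1)"
      by (subst eq_commute) (auto intro: times_z_minus_zd_cancel[of _ t])
    then show ?case
      using gD[of 1]
      by (simp add: dia_B dia_B1 sum_mset_distrib_right distrib_left distrib_right
          sum_mset.distrib mult.assoc)
  next
    case (z u)
    have "dia s' (Ft (Node h)) (v * z) = dia s' (Ft (Node h)) v * z" for s' h v
      by (simp add: dia_z_right A1_Ft)
    from this[of s g "w * zd t * u"] this[of t _ u] z show ?case
      by (simp add: mult.assoc[symmetric] distrib_right sum_mset_distrib_right)
  next
    case (zd u q)
    let ?W = "w * zd t * u"
    \<comment> \<open>Again two expansions are compared; the terms ending in \<open>zd q\<close>
      match by the assumed formula for \<open>u\<close>.\<close>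
    have "(\<Sum>p\<in>#copF g. D p * dia t (H (snd p)) (u * zd q)) * (z - zd q) + dia s (FF g) ?W * zd q
        = dia s (FF g) (?W * zd q)"
      using gD[of "u * zd q"] gD[of u]
      by (simp add: dia_H sum_mset_distrib_right distrib_left sum_mset.distrib mult.assoc)
    also have "\<dots> = dia s (H g) (?W * zd q) * (z - zd q) + dia s (FF g) ?W * zd q"
      by (rule dia_H)
    finally have "dia s (H g) (?W * zd q) = (\<Sum>p\<in>#copF g. D p * dia t (H (snd p)) (u * zd q))"
      by (subst eq_commute) (auto intro: times_z_minus_zd_cancel[of _ q])
    moreover have "dia s (Ft (Node g)) (w * zd t * (u * zd q)) = dia s (Ft (Node g)) ?W * zd q
      + (dia s (H g) (?W * zd q) * z + dia s (FF g) (w * zd t * (u * zd q))) * (z - zd q)"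
      using dia_B[of s g ?W q] by (simp add: mult.assoc)
    ultimately show ?case
      unfolding gD zd dia_B
      by (simp add: sum_mset_distrib_right distrib_left distrib_right
          sum_mset.distrib mult.assoc add.assoc)
  qed (simp_all add: dia_linear distrib_left sum_mset.distrib times_cst_left_commute sum_mset_distrib_left)
  then show ?thesis
    by (simp add: D_def)
qed

text \<open>Follows the construction of forests by grafting and products, so the hypothesis is
  available for the branches \<open>g\<close> of a tree as well as for the remaining trees.\<close>

lemma forest_induct [case_names empty add]:
  assumes "P {#}" and "\<And>g f. P g \<Longrightarrow> P f \<Longrightarrow> P (add_mset (Node g) f)"
  shows "P f"
proof -
  have "\<forall>f. P f \<longrightarrow> P (add_mset t f)" for t
  proof (induction t)
    case (Node g)
    have "P g"
      using Node by (induction g) (auto simp: assms(1))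
    then show ?case
      using assms(2) by blast
  qed
  then show ?thesis
    by (induction f) (auto simp: assms(1))
qed

text \<open>Trees are settled by \<open>Ft_coproduct\<close>. A product of forests acts by iterated
  diamonds, and applying the formula twice produces the product of the coproducts.\<close>

lemma FF_coproduct:
  "dia s (FF f) (w * zd t * u)
    = (\<Sum>p\<in>#copF f. dia s (FF (fst p)) w * zd t * dia t (FF (snd p)) u)"
proof (induction f arbitrary: s w t u rule: forest_induct)
  case empty
  show ?case by (simp add: copF_Nil FF_Nil dia_one_left)
next
  case (add g f)
  have tree: "dia s (FF {#Node g#}) (w * zd t * u)
      = (\<Sum>p\<in>#cop (Node g). dia s (FF (fst p)) w * zd t * dia t (FF (snd p)) u)" for s w t u
    using Ft_coproduct[of s g w t u, OF add.IH(1)]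
    by (simp add: cop_Node FF_single FF_Nil dia_one_left multiset.map_comp comp_def)
  have FF: "dia s' (FF (h + h')) v = dia s' (FF h) (dia s' (FF h') v)" for s' h h' v
    by (simp add: FF_add dia_assoc A1_FF)
  have "dia s (FF (add_mset (Node g) f)) (w * zd t * u)
      = dia s (FF {#Node g#}) (dia s (FF f) (w * zd t * u))"
    using FF[of s "{#Node g#}" f] by simp
  also have "\<dots> = (\<Sum>q\<in>#copF f. \<Sum>p\<in>#cop (Node g).
      dia s (FF (fst p)) (dia s (FF (fst q)) w) * zd t * dia t (FF (snd p)) (dia t (FF (snd q)) u))"
    by (simp add: add.IH(2) dia_sum_mset_right tree)
  also have "\<dots> = (\<Sum>p\<in>#copF (add_mset (Node g) f).
      dia s (FF (fst p)) w * zd t * dia t (FF (snd p)) u)"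
    by (simp add: copF_add_mset FF sum_mset.swap[of _ "copF f"]
        sum_pmulC[where h = "\<lambda>a b. dia s (FF a) w * zd t * dia t (FF b) u"])
  finally show ?case .
qed

section \<open>Grading by the number of vertices\<close>

lemma nv_pos: "0 < nv t"
  by (cases t) simp

lemma nvF_Nil: "nvF {#} = 0"
  and nvF_add_mset: "nvF (add_mset t f) = nv t + nvF f"
  and nvF_add: "nvF (f + g) = nvF f + nvF g"
  and nv_Node: "nv (Node f) = Suc (nvF f)"
  by (simp_all add: nvF_def)

declare nv.simps [simp del]

lemma nvF_eq_0_iff: "nvF f = 0 \<longleftrightarrow> f = {#}"
  by (cases f) (use nv_pos in \<open>auto simp: nvF_Nil nvF_add_mset\<close>)

lemma in_pmulC: "p \<in># pmulC A B \<Longrightarrow> \<exists>a\<in>#A. \<exists>b\<in>#B. p = (fst a + fst b, snd a + snd b)"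
  by (induction A) (auto simp: pmulC_empty_left pmulC_add_mset_left)

lemma nvF_copF: "p \<in># copF f \<Longrightarrow> nvF (fst p) + nvF (snd p) = nvF f"
proof (induction f arbitrary: p rule: forest_induct)
  case empty
  then show ?case by (simp add: copF_Nil nvF_Nil)
next
  case (add g f)
  from add.prems obtain a b where "a \<in># cop (Node g)" and b: "b \<in># copF f"
    and p: "p = (fst a + fst b, snd a + snd b)"
    using in_pmulC[OF add.prems[unfolded copF_add_mset]] by blast
  then have "nvF (fst a) + nvF (snd a) = nv (Node g)"
    using add.IH(1) by (auto simp: cop_Node nvF_add_mset nvF_Nil nv_Node)
  then show ?case
    using add.IH(2)[OF b] by (simp add: p nvF_add nvF_add_mset)
qed

text \<open>For nonempty \<open>f\<close> the grading excludes a term with both components empty, so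
  the two extreme terms are distinct and their removal in \<open>Wr\<close> leaves exactly the terms
  with both components nonempty.\<close>

lemma copF_split:
  assumes "f \<noteq> {#}"
  obtains R where "copF f = R + {#(f, {#}), ({#}, f)#}"
    and "\<And>p. p \<in># R \<Longrightarrow> fst p \<noteq> {#} \<and> snd p \<noteq> {#}"
proof -
  let ?R = "filter_mset (\<lambda>p. fst p \<noteq> {#} \<and> snd p \<noteq> {#}) (copF f)"
  have "nvF (fst p) + nvF (snd p) \<noteq> 0" if "p \<in># copF f" for p
    using nvF_copF[OF that] assms by (simp add: nvF_eq_0_iff)
  then have "filter_mset (\<lambda>p. \<not> (fst p \<noteq> {#} \<and> snd p \<noteq> {#})) (copF f)
      = filter_mset (\<lambda>p. snd p = {#}) (copF f) + filter_mset (\<lambda>p. fst p = {#}) (copF f)"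
    by (intro multiset_eqI) (force simp: nvF_Nil count_eq_zero_iff)
  also have "\<dots> = {#(f, {#}), ({#}, f)#}"
    unfolding filter_snd_copF filter_fst_copF by simp
  finally have "copF f = ?R + {#(f, {#}), ({#}, f)#}"
    using multiset_partition[of "copF f" "\<lambda>p. fst p \<noteq> {#} \<and> snd p \<noteq> {#}"] by argo
  then show ?thesis
    by (rule that) simp
qed

subsection \<open>Rooted tree maps\<close>

text \<open>The general clause of \<open>Wr\<close> also agrees with the one for a single letter:
  \<open>Wr Om f []\<close> is 0, and the terms of \<open>R\<close> vanish on the empty
  word.\<close>

lemma Wr_Cons:
  assumes "f \<noteq> {#}" and R: "copF f = R + {#(f, {#}), ({#}, f)#}"
    and "\<And>p. p \<in># R \<Longrightarrow> Om (fst p) [] = 0"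
  shows "Wr Om f (a # u) = Wr Om f u * lt a + wd (rev u) * gen Om f a
      + (\<Sum>p\<in>#R. Om (fst p) (rev u) * Om (snd p) [a])"
proof (cases u)
  case Nil
  have "(\<Sum>p\<in>#R. Om (fst p) [] * Om (snd p) [a]) = (\<Sum>p\<in>#R. 0)"
    by (intro arg_cong[where f = sum_mset] image_mset_cong) (simp add: assms(3))
  then show ?thesis
    using Nil by (simp add: wd_Nil)
next
  case (Cons b v)
  then show ?thesis
    by (simp add: pmul_eq_times R case_prod_unfold)
qed

text \<open>Extends the product rule by linearity from one final letter to combinations of two, the
  form of both \<open>z\<close> and \<open>zd t\<close>.\<close>

lemma Wr_times_letters:
  fixes Om :: "forest \<Rightarrow> word \<Rightarrow> poly" and f :: forest
  defines "T \<equiv> lin (\<lambda>u. Wr Om f (rev u))"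
  assumes f: "f \<noteq> {#}" and R: "copF f = R + {#(f, {#}), ({#}, f)#}"
    and Nil: "\<And>p. p \<in># R \<Longrightarrow> Om (fst p) [] = 0"
    and v: "v = lt a + cst c * lt b"
  shows "T (P * v) = T P * v + P * T v + (\<Sum>p\<in>#R. lin (Om (fst p)) P * lin (Om (snd p)) v)"
proof -
  have T_lt: "T (lt a) = gen Om f a" for a
    by (simp add: T_def lt_def lin_wd)
  have T_add: "T (P + Q) = T P + T Q" and T_cst: "T (cst c * P) = cst c * T P" for P Q c
    by (simp_all add: T_def lin_add lin_cst)
  have "T (P * lt a) = T P * lt a + P * T (lt a)
      + (\<Sum>p\<in>#R. lin (Om (fst p)) P * lin (Om (snd p)) (lt a))" for a
  proof (induction P rule: poly_wd_induct)
    case zero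
    show ?case by (simp add: T_def lin_zero)
  next
    case (wd u)
    have "T (wd u * lt a) = Wr Om f (a # rev u)"
      by (simp add: T_def lin_wd flip: wd_snoc)
    also have "\<dots> = Wr Om f (rev u) * lt a + wd u * gen Om f a
        + (\<Sum>p\<in>#R. Om (fst p) u * Om (snd p) [a])"
      using Wr_Cons[of f R Om a "rev u", OF f R Nil] by simp
    finally show ?case
      by (simp add: T_lt) (simp add: T_def lin_wd lt_def)
  next
    case (add P Q)
    then show ?case
      by (simp add: T_add lin_add distrib_right sum_mset.distrib)
  next
    case (scale k P)
    then show ?case
      by (simp add: T_cst lin_cst distrib_left mult.assoc sum_mset_distrib_left)
  qed
  then show ?thesis
    by (simp add: v T_add T_cst lin_add lin_cst distrib_left sum_mset.distrib
        times_cst_left_commute sum_mset_distrib_left)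
qed

lemma z_letters: "z = lt X + cst 1 * lt (Y 1)"
  and zd_letters: "zd t = lt X + cst (dl t) * lt (Y t)"
  by (simp_all add: z_def zd_eq xx_def y_def yy_def)

definition represented :: "(word \<Rightarrow> poly) \<Rightarrow> poly \<Rightarrow> bool" where
  "represented T F \<longleftrightarrow> (\<forall>s w. lin T (zd s * w) = zd s * dia s F w)"

text \<open>The grafting rule is the image of the recursion for \<open>Ft\<close> when
  \<open>y\<close> becomes \<open>z - zd s\<close>: the factor \<open>z + y\<close> turns into
  \<open>2z - zd s\<close>.\<close>

lemma gtree_eq:
  assumes "represented (Om g) (FF g)"
  shows "gtree Om g s = zd s * dia s (Ft (Node g)) 1"
proof (cases "g = {#}")
  case True
  then show ?thesis
    using dia_y_one[OF A1_one, of s] by (simp add: gtree_def Ft.simps pmul_eq_times dia_one_left)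
next
  case False
  then obtain v where v: "v \<in> A1" "FF g = v * y"
    using FF_times_y by blast
  have "lin (Om g) (zd s) = zd s * dia s v 1 * (z - zd s)"
    using assms[unfolded represented_def, rule_format, of s 1] v
    by (simp add: dia_y_one mult.assoc)
  then have "gtree Om g s = zd s * dia s v 1 * (z + z - zd s) * (z - zd s)"
    using False by (simp add: gtree_def Rm_eq_times Rinv_times sm_eq_times mult_2)
  moreover have "dia s (Ft (Node g)) 1 = dia s v 1 * (z + z - zd s) * (z - zd s)"
    using v False
    by (simp add: Ft_Node_eq dia_y_one dia_z_left dia_add_left A1_intros)
      (simp add: algebra_simps)
  ultimately show ?thesis
    by (simp add: mult.assoc)
qed

text \<open>A single tree is handled by \<open>gtree_eq\<close>. For several trees two maps are
  composed, and \<open>dia_assoc\<close> merges the iterated diamonds.\<close>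

lemma gen_on_letters:
  fixes Om :: "forest \<Rightarrow> word \<Rightarrow> poly" and f :: forest
  defines "T \<equiv> lin (\<lambda>u. Wr Om f (rev u))"
  assumes f: "f \<noteq> {#}" "nvF f \<le> Suc n"
    and rep: "\<And>g. nvF g \<le> n \<Longrightarrow> represented (Om g) (FF g)"
    and z: "\<And>g. g \<noteq> {#} \<Longrightarrow> nvF g \<le> n \<Longrightarrow> lin (Om g) z = 0"
  shows "T (zd s) = zd s * dia s (FF f) 1" and "T z = 0"
proof -
  have T: "T (lt a + cst c * lt b) = gen Om f a + cst c * gen Om f b" for a b c
    by (simp add: T_def lin_add lin_cst) (simp add: lt_def lin_wd)
  have "T (zd s) = zd s * dia s (FF f) 1 \<and> T z = 0"
  proof (cases "size f = 1")
    case True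
    then obtain t where "f = {#t#}"
      using size_1_singleton_mset by blast
    moreover obtain g where "t = Node g"
      by (cases t)
    ultimately have fg: "f = {#Node g#}"
      by simp
    have "gtree Om g s' = zd s' * dia s' (Ft (Node g)) 1" for s'
      using f rep[of g] by (intro gtree_eq) (simp add: fg nvF_add_mset nvF_Nil nv_Node)
    \<comment> \<open>The values on \<open>X\<close> and \<open>Y 1\<close> are opposite, hence
      \<open>T z = 0\<close>; for \<open>s \<noteq> 1\<close> the subtracted value on
      \<open>Y s\<close> cancels the one on \<open>X\<close>.\<close>
    then have X: "gen Om f X = zd 1 * dia 1 (Ft (Node g)) 1"
      and Y: "gen Om f (Y t) = (if t = 1 then 0 else zd t * dia t (Ft (Node g)) 1)
        - zd 1 * dia 1 (Ft (Node g)) 1" for t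
      by (simp_all add: gen_def fg)
    have "T (zd s) = gen Om f X + cst (dl s) * gen Om f (Y s)"
      and "T z = gen Om f X + cst 1 * gen Om f (Y 1)"
      unfolding zd_letters z_letters by (rule T)+
    then show ?thesis
      unfolding X Y by (simp add: fg FF_single dl_def)
  next
    case False
    \<comment> \<open>This is the choice made in \<open>gen\<close>. As \<open>f\<close> has at
      least two trees, \<open>{#t#}\<close> and the rest both have at most \<open>n\<close>
      vertices.\<close>
    define t where "t = (SOME t. t \<in># f)"
    have "t \<in># f"
      unfolding t_def using f(1) by (meson multiset_nonemptyE someI_ex)
    then obtain g where g: "f = add_mset t g"
      by (metis insert_DiffM)
    with False have "g \<noteq> {#}"
      by auto
    then have n: "nvF {#t#} \<le> n" "nvF g \<le> n"
      using f(2) nvF_eq_0_iff[of g] nv_pos[of t] by (auto simp: g nvF_add_mset nvF_Nil)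
    have "gen Om f a = lin (Om {#t#}) (lin (Om g) (lt a))" for a
      using False by (simp add: gen_def flip: t_def) (simp add: g lt_def lin_wd)
    then have "T (lt a + cst c * lt b) = lin (Om {#t#}) (lin (Om g) (lt a + cst c * lt b))" for a b c
      by (simp add: T lin_add lin_cst)
    then have Tv: "T v = lin (Om {#t#}) (lin (Om g) v)" if "v = z \<or> v = zd s" for v
      using that z_letters zd_letters by metis
    have "lin (Om g) (zd s) = zd s * dia s (FF g) 1"
      using rep[OF n(2)] unfolding represented_def by (metis mult.right_neutral)
    then have "T (zd s) = zd s * dia s (Ft t) (dia s (FF g) 1)"
      using rep[OF n(1)] by (simp add: Tv represented_def FF_single)
    then show ?thesis
      using z[OF \<open>g \<noteq> {#}\<close> n(2)]
      by (simp add: Tv lin_zero g FF_add_mset dia_assoc A1_Ft A1_FF)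
  qed
  then show "T (zd s) = zd s * dia s (FF f) 1" "T z = 0"
    by simp_all
qed

lemma tmn_Nil: "f \<noteq> {#} \<Longrightarrow> tmn n f [] = 0"
  by (cases n) simp_all

declare tmn.simps [simp del]

lemma represented_wd: "represented wd 1"
  by (simp add: represented_def lin_wd_id dia_one_left)

text \<open>Induction on the recursion depth \<open>n\<close> for all forests of at most
  \<open>n\<close> vertices, since \<open>Wr\<close> evaluates depth \<open>n\<close> at forests of
  various smaller sizes.\<close>

lemma tmn_represented:
  assumes "nvF f \<le> n"
  shows "represented (tmn n f) (FF f)" and "f \<noteq> {#} \<Longrightarrow> lin (tmn n f) z = 0"
proof -
  have "represented (tmn n f) (FF f) \<and> (f \<noteq> {#} \<longrightarrow> lin (tmn n f) z = 0)"
    using assms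
  proof (induction n arbitrary: f)
    case 0
    then have "f = {#}"
      by (simp add: nvF_eq_0_iff)
    moreover have "tmn 0 {#} = wd"
      by (simp add: fun_eq_iff tmn.simps)
    ultimately show ?case
      by (simp add: FF_Nil represented_wd)
  next
    case (Suc n)
    show ?case
    proof (cases "f = {#}")
      case True
      moreover have "tmn (Suc n) {#} = wd"
        by (simp add: fun_eq_iff tmn.simps)
      ultimately show ?thesis
        by (simp add: FF_Nil represented_wd)
    next
      case False
      let ?T = "lin (tmn (Suc n) f)"
      have T: "tmn (Suc n) f = (\<lambda>u. Wr (tmn n) f (rev u))"
        using False by (simp add: fun_eq_iff tmn.simps)
      have rep: "represented (tmn n g) (FF g)" if "nvF g \<le> n" for g
        using Suc.IH[OF that] by blast
      have tmn_z: "lin (tmn n g) z = 0" if "g \<noteq> {#}" "nvF g \<le> n" for g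
        using Suc.IH[of g] that by blast
      note letters = gen_on_letters[OF False Suc.prems, of "tmn n", OF rep tmn_z, folded T]
      obtain R where R: "copF f = R + {#(f, {#}), ({#}, f)#}"
        and R_ne: "\<And>p. p \<in># R \<Longrightarrow> fst p \<noteq> {#} \<and> snd p \<noteq> {#}"
        using copF_split[OF False] by blast
      have R_nv: "nvF (fst p) \<le> n" "nvF (snd p) \<le> n" if "p \<in># R" for p
        using nvF_copF[of p f] R_ne[OF that] Suc.prems that nvF_eq_0_iff[of "fst p"]
          nvF_eq_0_iff[of "snd p"] by (auto simp: R)
      have R_Nil: "tmn n (fst p) [] = 0" if "p \<in># R" for p
        using R_ne[OF that] by (simp add: tmn_Nil)
      have mult: "?T (P * v) = ?T P * v + P * ?T v
          + (\<Sum>p\<in>#R. lin (tmn n (fst p)) P * lin (tmn n (snd p)) v)"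
        if "v = lt a + cst c * lt b" for P v a b c
        unfolding T by (rule Wr_times_letters[of f R "tmn n", OF False R R_Nil that])
      have "?T (zd s * w) = zd s * dia s (FF f) w" for s w
      proof (induction w rule: poly_letter_induct)
        case one
        then show ?case using letters(1) by simp
      next
        case (z w)
        \<comment> \<open>Every right component in \<open>R\<close> is nonempty, so its map kills
          \<open>z\<close>.\<close>
        have "(\<Sum>p\<in>#R. lin (tmn n (fst p)) (zd s * w) * lin (tmn n (snd p)) z) = (\<Sum>p\<in>#R. 0)"
          by (intro arg_cong[where f = sum_mset] image_mset_cong)
            (simp add: R_ne R_nv tmn_z)
        then show ?case
          using mult[OF z_letters, of "zd s * w"] letters(2) z
          by (simp add: dia_z_right A1_FF mult.assoc)
      next
        case (zd w t)
        let ?h = "\<lambda>p. dia s (FF (fst p)) w * zd t * dia t (FF (snd p)) 1"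
        have "(\<Sum>p\<in>#R. lin (tmn n (fst p)) (zd s * w) * lin (tmn n (snd p)) (zd t))
            = (\<Sum>p\<in>#R. zd s * ?h p)"
        proof (intro arg_cong[where f = sum_mset] image_mset_cong)
          fix p assume p: "p \<in># R"
          have "lin (tmn n (fst p)) (zd s * w) = zd s * dia s (FF (fst p)) w"
            using rep[OF R_nv(1)[OF p]] by (simp add: represented_def)
          moreover have "lin (tmn n (snd p)) (zd t) = zd t * dia t (FF (snd p)) 1"
            using rep[OF R_nv(2)[OF p]] unfolding represented_def by (metis mult.right_neutral)
          ultimately show "lin (tmn n (fst p)) (zd s * w) * lin (tmn n (snd p)) (zd t) = zd s * ?h p"
            by (simp add: mult.assoc)
        qed
        \<comment> \<open>The coproduct formula at \<open>u = 1\<close>, with the two extreme terms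
          written separately, mirrors the product rule \<open>mult\<close>.\<close>
        moreover have "dia s (FF f) (w * zd t)
            = (\<Sum>p\<in>#R. ?h p) + dia s (FF f) w * zd t + w * zd t * dia t (FF f) 1"
          using FF_coproduct[of s f w t 1] by (simp add: R FF_Nil dia_one_left add.commute add.assoc)
        ultimately show ?case
          using mult[OF zd_letters, of "zd s * w" t] letters(1)[of t] zd
          by (simp add: distrib_left sum_mset_distrib_left mult.assoc add.commute add.left_commute)
      qed (simp_all add: dia_linear lin_add lin_cst distrib_left times_cst_left_commute)
      then show ?thesis
        using letters(2) by (simp add: represented_def)
    qed
  qed
  then show "represented (tmn n f) (FF f)" "f \<noteq> {#} \<Longrightarrow> lin (tmn n f) z = 0"
    by simp_all
qed

section \<open>Linear combinations of forests, membership in \<open>A11\<close>, and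
  uniqueness\<close>

lemma dia_sum_left: "dia s (\<Sum>i\<in>I. g i) w = (\<Sum>i\<in>I. dia s (g i) w)"
  by (induction I rule: infinite_finite_induct) (simp_all add: dia_linear)

lemma rtm_zd_times: "rtm h (zd s * w) = zd s * dia s (FH h) w"
proof -
  have "lin (rtmF f) (zd s * w) = zd s * dia s (FF f) w" for f
    using tmn_represented(1)[of f "nvF f"] by (simp add: rtmF_def represented_def)
  then show ?thesis
    by (simp add: rtm_def FH_def sm_eq_times dia_sum_left dia_cst_left sum_distrib_left
        times_cst_left_commute)
qed

lemma A11_zero: "0 \<in> A11"
  by (simp add: A11_def A1_zero)

lemma A11_add: "P \<in> A11 \<Longrightarrow> Q \<in> A11 \<Longrightarrow> P + Q \<in> A11"
  using Poly_Mapping.keys_add[of P Q] by (auto simp: A11_def A1_add)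

lemma A11_cst: "P \<in> A11 \<Longrightarrow> cst c * P \<in> A11"
  by (auto simp: A11_def A1_cst in_keys_iff lookup_cst_times)

lemma A11_one: "1 \<in> A11"
proof -
  have "wd [] \<in> A11"
    by (simp add: A11_def wd_in_A1_iff) (simp add: wd_def)
  then show ?thesis
    by (simp add: wd_Nil)
qed

lemma A11_times_y: "v \<in> A1 \<Longrightarrow> v * y \<in> A11"
  using Poly_Mapping.keys_mult[of v y]
  by (auto simp: A11_def A1_intros) (auto simp: y_def yy_def lt_def wd_def plus_list_def)

lemma A11_FF: "FF f \<in> A11"
  using FF_times_y[of f] by (cases "f = {#}") (auto simp: FF_Nil A11_one A11_times_y)

lemma A11_FH: "FH h \<in> A11"
proof -
  have "(\<Sum>f\<in>I. cst (Poly_Mapping.lookup h f) * FF f) \<in> A11" for I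
    by (induction I rule: infinite_finite_induct) (simp_all add: A11_zero A11_add A11_cst A11_FF)
  then show ?thesis
    by (simp add: FH_def sm_eq_times)
qed

theorem mainTheorem1:
  fixes r :: nat and f :: "forest \<Rightarrow>\<^sub>0 rat"
  assumes "1 \<le> r"
  shows "(\<exists>!F. F \<in> A11 \<and>
            (\<forall>s\<in>mu r. \<forall>w\<in>Ar r. rtm f (pmul (zd s) w) = pmul (zd s) (dia s F w)))
       \<and> FH f \<in> A11
       \<and> (\<forall>s\<in>mu r. \<forall>w\<in>Ar r. rtm f (pmul (zd s) w) = pmul (zd s) (dia s (FH f) w))"
proof -
  have FH: "rtm f (pmul (zd s) w) = pmul (zd s) (dia s (FH f) w)" for s w
    by (simp add: pmul_eq_times rtm_zd_times)
  have unique: "F = FH f"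
    if "F \<in> A11" and F: "\<forall>s\<in>mu r. \<forall>w\<in>Ar r. rtm f (pmul (zd s) w) = pmul (zd s) (dia s F w)" for F
  proof -
    have "1 \<in> mu r" and "wd [] \<in> Ar r"
      by (simp_all add: mu_def Ar_def wd_def)
    then have "zd 1 * dia 1 F 1 = zd 1 * dia 1 (FH f) 1"
      using F FH[of 1 1] by (metis pmul_eq_times wd_Nil)
    moreover have "F \<in> A1" "FH f \<in> A1"
      using that(1) A11_FH by (auto simp: A11_def)
    ultimately show ?thesis
      by (auto simp: dia_one_right zd_one dest: xx_left_cancel)
  qed
  show ?thesis
    using FH A11_FH unique by blast
qed

end
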